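(* Let $\mathbf X=(X,\mathbb X)$ be an $\alpha$-Hölder rough path over $\mathbb R^d$ on $[0,T]$ and let $(Z,Z')\in\mathcal D^\alpha_{\mathbf X}([0,T];\mathbb R^m)$. Then, for any $p\in\mathbb N$, there exists a constant $C_{p,T}>0$ such that for all $0\le s\le r\le t\le T$ and all $\eta\in\mathcal F_{\le p}$, the path $(Z^\eta_{s,\cdot},(Z^\eta_{s,\cdot})')$ is $\mathbf X$-controlled on $[s,T]$ and satisfies $$|Z^\eta_{s,r}|\le C_{p,T}|r-s|^{|\eta|\alpha},\qquad |(Z^\eta_{s,\cdot})'_r|\le C_{p,T}|r-s|^{(|\eta|-1)\alpha},$$ $$\|(Z^\eta_{s,\cdot})'\|_{\alpha;[s,t]}+\|R^{Z^\eta_{s,\cdot}}\|_{2\alpha;[s,t]}\le C_{p,T}|t-s|^{(|\eta|-2)_+\alpha},$$ where $R^{Z^\eta_{s,\cdot}}_{u,v}:=Z^\eta_{s,v}-Z^\eta_{s,u}-(Z^\eta_{s,\cdot})'_uX_{u,v}$ and $(x)_+=\max\{x,0\}$.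
   Context: Fix $\alpha\in(1/3,1/2]$, $T>0$ and $d,m\in\mathbb N=\{1,2,\dots\}$. Write $X_{s,t}:=X_t-X_s$ for increments. Rough and controlled paths. An $\alpha$-Hölder rough path over $\mathbb R^d$ is a pair $\mathbf X=(X,\mathbb X)$ with $X\in C^\alpha([0,T];\mathbb R^d)$ and $\mathbb X:\{0\le s\le t\le T\}\to\mathbb R^{d\times d}$ with $\|\mathbb X\|_{2\alpha;[0,T]}=\sup_{s<t}|\mathbb X_{s,t}|/|t-s|^{2\alpha}<\infty$ and $\mathbb X_{s,t}=\mathbb X_{s,u}+\mathbb X_{u,t}+X_{s,u}\otimes X_{u,t}$ for $s\le u\le t$. For a finite-dimensional space $V$, $\mathcal D^\alpha_{\mathbf X}([0,T];V)$ is the set of pairs $(Y,Y')$ with $Y\in C^\alpha([0,T];V)$, $Y'\in C^\alpha([0,T];\mathcal L(\mathbb R^d,V))$ and $\|R^Y\|_{2\alpha;[0,T]}<\infty$, where $R^Y_{s,t}:=Y_{s,t}-Y'_sX_{s,t}$; such a pair is called $\mathbf X$-controlled and $Y'$ its Gubinelli derivative. The same definitions apply on subintervals; $\|\cdot\|_{\alpha;[s,t]}$ and $\|\cdot\|_{2\alpha;[s,t]}$ are the corresponding Hölder seminorms on $[s,t]$ (for one-parameter paths, resp. two-parameter functions). Controlled rough integral. For controlled $(H,H')$ with values in $\mathcal L(\mathbb R^k,V)$ and controlled $(W,W')$ with values in $\mathbb R^k$, $$\int_s^tH_r\,d\mathbf W_r:=\lim_{|P|\to0}\sum_{[u,v]\in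 P}\bigl(H_uW_{u,v}+(H'_u\diamond W'_u)\mathbb X_{u,v}\bigr),$$ over partitions $P$ of $[s,t]$ (the limit exists), where $(A\diamond B)(x\otimes\tilde x):=A(x)(B\tilde x)$. The indefinite integral is $\mathbf X$-controlled with Gubinelli derivative $H_tW'_t$. Trees and forests. Let $\mathcal A=\{1,\dots,m\}$. $\mathcal T$ is the set of (nonplanar) rooted trees with vertices decorated by $\mathcal A$; $\mathcal F^0$ is the free commutative monoid generated by $\mathcal T$, with unit the empty forest $\mathbf 1$; $\mathcal F=\mathcal F^0\setminus\{\mathbf 1\}$. For $\eta=\tau_1\cdots\tau_n\in\mathcal F^0$ and $a\in\mathcal A$, $[\eta]_a$ is the tree obtained by joining the roots of $\tau_1,\dots,\tau_n$ to a new root decorated by $a$; $\bullet_a=[\mathbf 1]_a$. $|\eta|$ is the number of vertices and $\mathcal F_{\le p}=\{\eta\in\mathcal F:|\eta|\le p\}$. Controlled coefficients. Write $\mathbf Z=(Z,Z')$ with components $\mathbf Z^a=(Z^a,(Z^a)')$. For fixed $s$ and $t\in[s,T]$ define recursively $Z^{\mathbf 1}_{s,t}:=1$; $Z^{\tau_1\cdots\tau_n}_{s,t}:=\prod_{j=1}^nZ^{\tau_j}_{s,t}$; and $Z^{[\eta]_a}_{s,t}:=\int_s^tZ^\eta_{s,u}\,d\mathbf Z^a_u$ (controlled rough integral). The Gubinelli derivatives of $r\mapsto Z^\eta_{s,r}$ are given accordingly by $(Z^{\mathbf 1}_{s,\cdot})'=0$, the product rule $(Z^{\tau_1\cdots\tau_n}_{s,\cdot})'_r=\sum_{j}(Z^{\tau_j}_{s,\cdot})'_r\prod_{i\ne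 j}Z^{\tau_i}_{s,r}$, and $(Z^{[\eta]_a}_{s,\cdot})'_r=Z^\eta_{s,r}(Z^a)'_r$. *)

theory Defs
  imports "HOL-Analysis.Analysis" "HOL-Library.Multiset"
begin

text \<open>Euclidean spaces are \<open>real ^ 'd\<close> and \<open>real ^ 'm\<close>, the alphabet
  $\{1,\dots,m\}$ is the index type \<open>'m\<close>, and $\mathcal L(V,W)$ is \<open>V \<Rightarrow>\<^sub>L W\<close> with the operator
  norm. The matrix space \<open>real ^ 'd ^ 'd\<close> carries the Frobenius norm.\<close>


subsection \<open>Rough paths and controlled paths\<close>

text \<open>The seminorms take values in \<^typ>\<open>ennreal\<close>: the value is \<open>\<infinity>\<close> exactly when the quotients are
  unbounded, and it is \<open>0\<close> when \<open>a = b\<close>.\<close>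

definition holder2_seminorm ::
    "real \<Rightarrow> real \<Rightarrow> real \<Rightarrow> (real \<Rightarrow> real \<Rightarrow> 'v::real_normed_vector) \<Rightarrow> ennreal" where
  "holder2_seminorm \<beta> a b R =
     (SUP (u, v) \<in> {(u, v). a \<le> u \<and> u < v \<and> v \<le> b}. ennreal (norm (R u v) / \<bar>v - u\<bar> powr \<beta>))"

definition holder_seminorm ::
    "real \<Rightarrow> real \<Rightarrow> real \<Rightarrow> (real \<Rightarrow> 'v::real_normed_vector) \<Rightarrow> ennreal" where
  "holder_seminorm \<beta> a b f = holder2_seminorm \<beta> a b (\<lambda>u v. f v - f u)"

definition tensor :: "real ^ 'd \<Rightarrow> real ^ 'd \<Rightarrow> real ^ 'd ^ 'd" where
  "tensor x y = (\<chi> i j. x $ i * y $ j)"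

definition rough_path ::
    "real \<Rightarrow> real \<Rightarrow> real \<Rightarrow> (real \<Rightarrow> real ^ 'd) \<Rightarrow> (real \<Rightarrow> real \<Rightarrow> real ^ 'd ^ 'd) \<Rightarrow> bool" where
  "rough_path \<alpha> a b X XX \<longleftrightarrow>
     holder_seminorm \<alpha> a b X < \<infinity> \<and>
     holder2_seminorm (2 * \<alpha>) a b XX < \<infinity> \<and>
     (\<forall>s u t. a \<le> s \<and> s \<le> u \<and> u \<le> t \<and> t \<le> b \<longrightarrow>
        XX s t = XX s u + XX u t + tensor (X u - X s) (X t - X u))"

definition remainder ::
    "(real \<Rightarrow> real ^ 'd) \<Rightarrow> (real \<Rightarrow> 'v) \<Rightarrow> (real \<Rightarrow> (real ^ 'd) \<Rightarrow>\<^sub>L 'v) \<Rightarrow>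
     real \<Rightarrow> real \<Rightarrow> 'v::real_normed_vector" where
  "remainder X Y Y' u v = Y v - Y u - blinfun_apply (Y' u) (X v - X u)"

definition controlled ::
    "real \<Rightarrow> real \<Rightarrow> real \<Rightarrow> (real \<Rightarrow> real ^ 'd) \<Rightarrow> (real \<Rightarrow> 'v::euclidean_space) \<Rightarrow>
     (real \<Rightarrow> (real ^ 'd) \<Rightarrow>\<^sub>L 'v) \<Rightarrow> bool" where
  "controlled \<alpha> a b X Y Y' \<longleftrightarrow>
     holder_seminorm \<alpha> a b Y < \<infinity> \<and>
     holder_seminorm \<alpha> a b Y' < \<infinity> \<and>
     holder2_seminorm (2 * \<alpha>) a b (remainder X Y Y') < \<infinity>"


subsection \<open>The controlled rough integral\<close>

text \<open>The linear extension to all matrices of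
  $(A \diamond B)(x \otimes \tilde x) = A(x)(B\tilde x)$.\<close>

definition diamond ::
    "((real ^ 'd) \<Rightarrow>\<^sub>L ('k::euclidean_space \<Rightarrow>\<^sub>L 'v::euclidean_space)) \<Rightarrow>
     ((real ^ 'd) \<Rightarrow>\<^sub>L 'k) \<Rightarrow> real ^ 'd ^ 'd \<Rightarrow> 'v" where
  "diamond A B M =
     (\<Sum>i\<in>UNIV. \<Sum>j\<in>UNIV.
        M $ i $ j *\<^sub>R blinfun_apply (blinfun_apply A (axis i 1)) (blinfun_apply B (axis j 1)))"

text \<open>The filter of partitions of $[s,t]$ with mesh tending to $0$. A division may contain
  degenerate intervals $[u,u]$; these contribute nothing to the sums below, because Chen's relation
  forces $\mathbb X_{u,u} = 0$.\<close>

definition fine_divisions :: "real \<Rightarrow> real \<Rightarrow> real set set filter" where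
  "fine_divisions s t =
     (INF \<delta>\<in>{0<..}. principal {P. P division_of {s..t} \<and> (\<forall>K\<in>P. diameter K < \<delta>)})"

definition rough_integral ::
    "(real \<Rightarrow> real \<Rightarrow> real ^ 'd ^ 'd) \<Rightarrow>
     (real \<Rightarrow> 'k::euclidean_space \<Rightarrow>\<^sub>L 'v::euclidean_space) \<Rightarrow>
     (real \<Rightarrow> (real ^ 'd) \<Rightarrow>\<^sub>L ('k \<Rightarrow>\<^sub>L 'v)) \<Rightarrow>
     (real \<Rightarrow> 'k) \<Rightarrow> (real \<Rightarrow> (real ^ 'd) \<Rightarrow>\<^sub>L 'k) \<Rightarrow> real \<Rightarrow> real \<Rightarrow> 'v" where
  "rough_integral XX H H' W W' s t =
     Lim (fine_divisions s t)
       (\<lambda>P. \<Sum>K\<in>P. let u = Inf K; v = Sup K in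
          blinfun_apply (H u) (W v - W u) + diamond (H' u) (W' u) (XX u v))"


subsection \<open>Decorated nonplanar rooted trees and forests\<close>

text \<open>Multisets of children make the trees nonplanar. The free commutative monoid $\mathcal F^0$ on
  the trees is the type of multisets of trees: its unit is \<open>{#}\<close>, its product is \<open>+\<close>,
  and $[\eta]_a$ is \<open>Node a \<eta>\<close>.\<close>

datatype 'a rtree = Node 'a "'a rtree multiset"

type_synonym 'a forest = "'a rtree multiset"

primrec tree_vertices :: "'a rtree \<Rightarrow> nat" where
  "tree_vertices (Node a \<eta>) = 1 + \<Sum>\<^sub># (image_mset tree_vertices \<eta>)"

definition vertices :: "'a forest \<Rightarrow> nat" where
  "vertices \<eta> = (\<Sum>\<tau>\<in>#\<eta>. tree_vertices \<tau>)"

definition forests_upto :: "nat \<Rightarrow> 'a forest set" where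
  "forests_upto p = {\<eta>. \<eta> \<noteq> {#} \<and> vertices \<eta> \<le> p}"


subsection \<open>Controlled coefficients\<close>

text \<open>A real-valued path paired with its Gubinelli derivative.\<close>

type_synonym 'd cpath = "(real \<Rightarrow> real) \<times> (real \<Rightarrow> (real ^ 'd) \<Rightarrow>\<^sub>L real)"

definition component ::
    "(real \<Rightarrow> real ^ 'm) \<Rightarrow> (real \<Rightarrow> (real ^ 'd::finite) \<Rightarrow>\<^sub>L (real ^ 'm)) \<Rightarrow> 'm \<Rightarrow> 'd cpath" where
  "component Z Z' a = (\<lambda>t. Z t $ a, \<lambda>t. Blinfun (\<lambda>x. blinfun_apply (Z' t) x $ a))"

text \<open>Pointwise product with derivative given by the product rule; the factors and the sum are
  counted with multiplicity, and the empty product is \<open>(1, 0)\<close>.\<close>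

definition cprod :: "'d::finite cpath multiset \<Rightarrow> 'd cpath" where
  "cprod M =
     (\<lambda>r. \<Prod>y\<in>#M. fst y r,
      \<lambda>r. \<Sum>y\<in>#M. (\<Prod>w\<in>#M - {#y#}. fst w r) *\<^sub>R snd y r)"

text \<open>A scalar integrand $H$ is regarded as the $\mathcal L(\mathbb R,\mathbb R)$-valued path
  $x \mapsto H_r x$, and $H'$ correspondingly.\<close>

definition cintegral ::
    "(real \<Rightarrow> real \<Rightarrow> real ^ 'd ^ 'd) \<Rightarrow> real \<Rightarrow> 'd::finite cpath \<Rightarrow> 'd cpath \<Rightarrow> 'd cpath" where
  "cintegral XX s y w =
     (\<lambda>r. rough_integral XX
        (\<lambda>u. blinfun_mult_right (fst y u)) (\<lambda>u. Blinfun blinfun_mult_right o\<^sub>L snd y u)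
        (fst w) (snd w) s r,
      \<lambda>r. fst y r *\<^sub>R snd w r)"

primrec tree_coeff ::
    "(real \<Rightarrow> real \<Rightarrow> real ^ 'd ^ 'd) \<Rightarrow> (real \<Rightarrow> real ^ 'm) \<Rightarrow>
     (real \<Rightarrow> (real ^ 'd::finite) \<Rightarrow>\<^sub>L (real ^ 'm)) \<Rightarrow> real \<Rightarrow> 'm rtree \<Rightarrow> 'd cpath" where
  "tree_coeff XX Z Z' s (Node a \<eta>) =
     cintegral XX s (cprod (image_mset (tree_coeff XX Z Z' s) \<eta>)) (component Z Z' a)"

definition forest_coeff_pair ::
    "(real \<Rightarrow> real \<Rightarrow> real ^ 'd ^ 'd) \<Rightarrow> (real \<Rightarrow> real ^ 'm) \<Rightarrow>
     (real \<Rightarrow> (real ^ 'd::finite) \<Rightarrow>\<^sub>L (real ^ 'm)) \<Rightarrow> real \<Rightarrow> 'm forest \<Rightarrow> 'd cpath" where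
  "forest_coeff_pair XX Z Z' s \<eta> = cprod (image_mset (tree_coeff XX Z Z' s) \<eta>)"

text \<open>$Z^\eta_{s,r}$ and $(Z^\eta_{s,\cdot})'_r$.\<close>

definition forest_coeff ::
    "(real \<Rightarrow> real \<Rightarrow> real ^ 'd ^ 'd) \<Rightarrow> (real \<Rightarrow> real ^ 'm) \<Rightarrow>
     (real \<Rightarrow> (real ^ 'd::finite) \<Rightarrow>\<^sub>L (real ^ 'm)) \<Rightarrow> 'm forest \<Rightarrow> real \<Rightarrow> real \<Rightarrow> real" where
  "forest_coeff XX Z Z' \<eta> s r = fst (forest_coeff_pair XX Z Z' s \<eta>) r"

definition forest_coeff_deriv ::
    "(real \<Rightarrow> real \<Rightarrow> real ^ 'd ^ 'd) \<Rightarrow> (real \<Rightarrow> real ^ 'm) \<Rightarrow>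
     (real \<Rightarrow> (real ^ 'd::finite) \<Rightarrow>\<^sub>L (real ^ 'm)) \<Rightarrow> 'm forest \<Rightarrow> real \<Rightarrow> real \<Rightarrow> (real ^ 'd) \<Rightarrow>\<^sub>L real" where
  "forest_coeff_deriv XX Z Z' \<eta> s r = snd (forest_coeff_pair XX Z Z' s \<eta>) r"

text \<open>\<open>powr\<close> has \<open>0 powr 0 = 0\<close>, whereas the exponents $(|\eta|-1)\alpha$ and $(|\eta|-2)_+\alpha$
  can vanish and require $0^0 = 1$.\<close>

definition rpow :: "real \<Rightarrow> real \<Rightarrow> real" where
  "rpow x e = (if e = 0 then 1 else x powr e)"

end

theory Submission imports Defs begin

text \<open>
  Every forest coefficient arises from constants by two operations: multiplying controlled paths and
  integrating against the driver. Call a family $y_s$ of scalar controlled paths, one for every base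
  point $s$, graded of grade $n$ if it satisfies the four estimates of the theorem with $n$ in place
  of $|\eta|$ and with a constant that does not depend on $s$ (\<open>graded\<close>). The theorem follows
  by structural induction on trees once two closure properties are known: products add the grades
  (\<open>graded_cmult\<close>), and integration raises the grade by one (\<open>graded_cintegral\<close>). Only finitely many
  forests have at most $p$ vertices, so one constant serves them all.

  The product rule is a matter of expanding increments and remainders. For the integral, put
  $\Xi_{u,v} = y_u W_{u,v} + (y'_u \diamond W'_u) \mathbb X_{u,v}$. Chen's relation shows that the
  failure of additivity of $\Xi$ is a sum of five terms of third order in the increments. As
  $3\alpha > 1$, a sewing argument gives an additive function close to $\Xi$ (\<open>sewing\<close>), and
  this function is the limit of the compensated Riemann sums over arbitrary fine divisions
  (\<open>additive_limit_of_division_sums\<close>), hence the rough integral.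

  The weights in $t - s$ force the sewing estimate to be local. On $[s,V]$ the defect constant of
  $\Xi$ is a multiple of $|V-s|^{(n-2)_+\alpha}$, so that the sewing error on $[u,v]$ has to be bounded
  by the constant belonging to $[s,v]$, although the additive function was built on all
  of $[s,T]$. This is why the sewing theorem permits a separate constant for every subinterval.
\<close>

section \<open>Sewing of almost additive germs\<close>

text \<open>The interval is part of the notion: on a short interval the best constant \<open>c\<close> can be much
  smaller, and this gain puts a weight in $v - s$ on the error of an integral over $[u,v]$ with base
  point $s$.\<close>
definition defect_le :: "(real \<Rightarrow> real \<Rightarrow> 'v::real_normed_vector) \<Rightarrow> real \<Rightarrow> real \<Rightarrow> real \<Rightarrow> real \<Rightarrow> bool" where
  "defect_le \<Xi> \<theta> c a b \<longleftrightarrow> (\<forall>u w v. a \<le> u \<and> u \<le> w \<and> w \<le> v \<and> v \<le> b \<longrightarrow>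
     norm (\<Xi> u v - \<Xi> u w - \<Xi> w v) \<le> c * (v - u) powr \<theta>)"

lemma defect_leD:
  assumes "defect_le \<Xi> \<theta> c a b" "a \<le> u" "u \<le> w" "w \<le> v" "v \<le> b"
  shows "norm (\<Xi> u v - \<Xi> u w - \<Xi> w v) \<le> c * (v - u) powr \<theta>"
  using assms unfolding defect_le_def by blast

lemma defect_le_subinterval:
  assumes "defect_le \<Xi> \<theta> c a b" "a \<le> a'" "b' \<le> b"
  shows "defect_le \<Xi> \<theta> c a' b'"
  using assms unfolding defect_le_def by (meson order_trans)

lemma defect_le_diagonal:
  assumes "defect_le \<Xi> \<theta> c a b" "a \<le> u" "u \<le> b"
  shows "\<Xi> u u = 0"
  using defect_leD[OF assms(1,2) order_refl order_refl assms(3)] by simp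

text \<open>The solution of $C = 2 \cdot C / 2^\theta + 2$. In a bisection step the two halves contribute
  $C / 2^\theta$ each, and the two defects contribute $1$ each.\<close>
definition sewing_const :: "real \<Rightarrow> real" where
  "sewing_const \<theta> = 2 / (1 - 2 powr (1 - \<theta>))"

lemma two_powr_less_1: "1 < \<theta> \<Longrightarrow> 2 powr (1 - \<theta>) < (1::real)"
  using powr_less_mono[of "1 - \<theta>" 0 "2::real"] by simp

lemma sewing_const_nonneg: "1 < \<theta> \<Longrightarrow> 0 \<le> sewing_const \<theta>"
  using two_powr_less_1[of \<theta>] by (simp add: sewing_const_def)

lemma sewing_const_fixpoint:
  assumes "1 < \<theta>" shows "2 * (sewing_const \<theta> / 2 powr \<theta>) + 2 = sewing_const \<theta>"
proof -
  define q :: real where "q = 2 powr (1 - \<theta>)"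
  have q: "q < 1" using two_powr_less_1[OF assms] by (simp add: q_def)
  have "2 / 2 powr \<theta> = q" by (simp add: q_def powr_diff)
  hence "2 * (sewing_const \<theta> / 2 powr \<theta>) = q * sewing_const \<theta>" by (simp add: field_simps)
  also have "\<dots> + 2 = sewing_const \<theta>"
    using q by (simp add: sewing_const_def flip: q_def) (simp add: field_simps)
  finally show ?thesis .
qed

lemma mono_chain_bracket:
  fixes x :: "nat \<Rightarrow> real"
  assumes "i < j" "x i \<le> y" "y \<le> x j"
  obtains k where "i \<le> k" "k < j" "x k \<le> y" "y \<le> x (Suc k)"
proof -
  define l where "l = (LEAST l. i < l \<and> y \<le> x l)"
  have l: "i < l \<and> y \<le> x l" unfolding l_def by (rule LeastI[of _ j]) (use assms in auto)
  have le: "l \<le> j" unfolding l_def by (rule Least_le) (use assms in auto)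
  have "x (l - 1) \<le> y"
  proof (cases "l = Suc i")
    case False
    hence "i < l - 1" "l - 1 < l" using l by auto
    thus ?thesis using not_less_Least[of "l - 1" "\<lambda>l. i < l \<and> y \<le> x l"] by (simp flip: l_def)
  qed (use assms in auto)
  thus ?thesis using l le by (intro that[of "l - 1"]) auto
qed

text \<open>Cut the chain at the cell \<open>[x k, x (Suc k)]\<close> that contains the midpoint. Both remaining chains
  have at most half the length, so induction applies to them with the factor $2^{-\theta}$; since
  $\theta > 1$ the two halves together still leave room for the two defects made by the cuts.\<close>
lemma bisection_sum_bound:
  fixes \<Xi> :: "real \<Rightarrow> real \<Rightarrow> 'v::real_normed_vector" and x :: "nat \<Rightarrow> real"
  assumes "1 < \<theta>" "0 \<le> c" "mono x" "i \<le> j" "defect_le \<Xi> \<theta> c (x i) (x j)"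
  shows "norm ((\<Sum>k=i..<j. \<Xi> (x k) (x (Suc k))) - \<Xi> (x i) (x j))
         \<le> sewing_const \<theta> * c * (x j - x i) powr \<theta>"
  using assms(4,5)
proof (induction "j - i" arbitrary: i j rule: less_induct)
  case less
  let ?S = "\<lambda>i j. \<Sum>k=i..<j. \<Xi> (x k) (x (Suc k))"
  define L where "L = x j - x i"
  have L: "0 \<le> L" using less.prems(1) \<open>mono x\<close> by (simp add: L_def mono_def)
  show ?case
  proof (cases "i = j")
    case True
    thus ?thesis using defect_le_diagonal[OF less.prems(2), of "x i"] by simp
  next
    case False
    hence "i < j" using less.prems by simp
    then obtain k where k: "i \<le> k" "k < j" "x k \<le> (x i + x j) / 2" "(x i + x j) / 2 \<le> x (Suc k)"
      by (rule mono_chain_bracket[of i j x "(x i + x j) / 2"]) (use L in \<open>auto simp: L_def\<close>)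
    have o: "x i \<le> x k" "x k \<le> x (Suc k)" "x (Suc k) \<le> x j"
      using k \<open>mono x\<close> by (auto simp: mono_def)
    have half: "sewing_const \<theta> * c * l powr \<theta> \<le> c * (sewing_const \<theta> / 2 powr \<theta>) * L powr \<theta>"
      if "0 \<le> l" "l \<le> L / 2" for l
    proof -
      have "l powr \<theta> \<le> (L / 2) powr \<theta>" using that assms(1) by (intro powr_mono2) auto
      also have "\<dots> = L powr \<theta> / 2 powr \<theta>" using L by (simp add: powr_divide)
      finally show ?thesis
        using mult_left_mono[of "l powr \<theta>" "L powr \<theta> / 2 powr \<theta>" "sewing_const \<theta> * c"]
          assms(2) sewing_const_nonneg[OF assms(1)] by (simp add: field_simps)
    qed
    have left: "norm (?S i k - \<Xi> (x i) (x k)) \<le> c * (sewing_const \<theta> / 2 powr \<theta>) * L powr \<theta>"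
      using less.hyps[OF _ k(1)] defect_le_subinterval[OF less.prems(2), of "x i" "x k"] k o
        half[of "x k - x i"] by (force simp: L_def diff_less_mono)
    have right: "norm (?S (Suc k) j - \<Xi> (x (Suc k)) (x j))
        \<le> c * (sewing_const \<theta> / 2 powr \<theta>) * L powr \<theta>"
      using less.hyps[of j "Suc k"] defect_le_subinterval[OF less.prems(2), of "x (Suc k)" "x j"] k o
        half[of "x j - x (Suc k)"] by (force simp: L_def)
    have d1: "norm (\<Xi> (x i) (x j) - \<Xi> (x i) (x k) - \<Xi> (x k) (x j)) \<le> c * L powr \<theta>"
      unfolding L_def using o by (intro defect_leD[OF less.prems(2)]) auto
    have "norm (\<Xi> (x k) (x j) - \<Xi> (x k) (x (Suc k)) - \<Xi> (x (Suc k)) (x j))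
        \<le> c * (x j - x k) powr \<theta>"
      using o by (intro defect_leD[OF less.prems(2)]) auto
    also have "\<dots> \<le> c * L powr \<theta>"
      using o assms(1,2) by (intro mult_left_mono powr_mono2) (auto simp: L_def)
    finally have d2: "norm (\<Xi> (x k) (x j) - \<Xi> (x k) (x (Suc k)) - \<Xi> (x (Suc k)) (x j))
        \<le> c * L powr \<theta>" .
    have "?S i j = ?S i k + (\<Xi> (x k) (x (Suc k)) + ?S (Suc k) j)"
      using k sum.atLeastLessThan_concat[of i k j "\<lambda>k. \<Xi> (x k) (x (Suc k))"]
        sum.atLeast_Suc_lessThan[of k j "\<lambda>k. \<Xi> (x k) (x (Suc k))"] by simp
    hence "?S i j - \<Xi> (x i) (x j) = (?S i k - \<Xi> (x i) (x k)) + (?S (Suc k) j - \<Xi> (x (Suc k)) (x j))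
      - (\<Xi> (x i) (x j) - \<Xi> (x i) (x k) - \<Xi> (x k) (x j))
      - (\<Xi> (x k) (x j) - \<Xi> (x k) (x (Suc k)) - \<Xi> (x (Suc k)) (x j))" by simp
    also have "norm \<dots> \<le> 2 * (c * (sewing_const \<theta> / 2 powr \<theta>) * L powr \<theta>) + 2 * (c * L powr \<theta>)"
      using left right d1 d2 by (smt (verit) norm_triangle_ineq norm_triangle_ineq4)
    also have "\<dots> = (2 * (sewing_const \<theta> / 2 powr \<theta>) + 2) * c * L powr \<theta>"
      by (simp add: algebra_simps)
    finally show ?thesis unfolding sewing_const_fixpoint[OF assms(1)] L_def .
  qed
qed

text \<open>All intervals are summed along clipped copies of one and the same dyadic grid. Grid sums over
  adjacent intervals then differ from the sum over their union only by defects inside single cells,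
  which makes the limit additive.\<close>
definition clip :: "real \<Rightarrow> real \<Rightarrow> real \<Rightarrow> real" where
  "clip u v x = max u (min v x)"

definition grid :: "real \<Rightarrow> real \<Rightarrow> nat \<Rightarrow> nat \<Rightarrow> real" where
  "grid a b n k = a + real k * ((b - a) / 2 ^ n)"

definition grid_sum ::
    "(real \<Rightarrow> real \<Rightarrow> 'v::real_normed_vector) \<Rightarrow> real \<Rightarrow> real \<Rightarrow> nat \<Rightarrow> real \<Rightarrow> real \<Rightarrow> 'v" where
  "grid_sum \<Xi> a b n u v =
     (\<Sum>k<2 ^ n. \<Xi> (clip u v (grid a b n k)) (clip u v (grid a b n (Suc k))))"

lemma clip_mono: "x \<le> y \<Longrightarrow> clip u v x \<le> clip u v y"
  by (auto simp: clip_def)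

lemma clip_bounds: "u \<le> v \<Longrightarrow> u \<le> clip u v x \<and> clip u v x \<le> v"
  by (auto simp: clip_def)

lemma clip_diff_le: "x \<le> y \<Longrightarrow> clip u v y - clip u v x \<le> y - x"
  by (auto simp: clip_def)

lemma grid_mono: "a \<le> b \<Longrightarrow> mono (grid a b n)"
  by (auto simp: grid_def mono_def intro!: divide_right_mono mult_right_mono)

lemma grid_diff: "grid a b n (Suc k) - grid a b n k = (b - a) / 2 ^ n"
  by (simp add: grid_def add_divide_distrib distrib_right)

lemma grid_Suc_even: "grid a b (Suc n) (2 * k) = grid a b n k"
  by (simp add: grid_def field_simps)

lemma sum_dyadic_pairs:
  fixes f :: "nat \<Rightarrow> 'v::comm_monoid_add"
  shows "(\<Sum>k<2 * n. f k) = (\<Sum>k<n. f (2 * k) + f (Suc (2 * k)))"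
  by (induction n) (simp_all add: add.assoc)

lemma mesh_sum_eq:
  fixes a b c \<theta> :: real
  assumes "a \<le> b"
  shows "real (2 ^ n) * (c * ((b - a) / 2 ^ n) powr \<theta>) = c * (b - a) powr \<theta> * (2 powr (1 - \<theta>)) ^ n"
proof -
  have "((2::real) ^ n) powr \<theta> = (2 powr \<theta>) ^ n"
    by (induction n) (simp_all add: powr_mult)
  hence "((b - a) / 2 ^ n) powr \<theta> = (b - a) powr \<theta> / (2 powr \<theta>) ^ n"
    using assms by (simp add: powr_divide)
  moreover have "((2::real) powr (1 - \<theta>)) ^ n = 2 ^ n / (2 powr \<theta>) ^ n"
    by (simp add: powr_diff power_divide)
  ultimately show ?thesis by simp
qed

lemma grid_sum_refine:
  fixes \<Xi> :: "real \<Rightarrow> real \<Rightarrow> 'v::real_normed_vector"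
  assumes "1 < \<theta>" "0 \<le> c" "defect_le \<Xi> \<theta> c a b" "a \<le> u" "u \<le> v" "v \<le> b"
  shows "norm (grid_sum \<Xi> a b (Suc n) u v - grid_sum \<Xi> a b n u v)
         \<le> c * (b - a) powr \<theta> * (2 powr (1 - \<theta>)) ^ n"
proof -
  let ?x = "\<lambda>n k. clip u v (grid a b n k)"
  have ab: "a \<le> b" using assms by simp
  let ?D = "\<lambda>k. \<Xi> (?x n k) (?x n (Suc k)) - \<Xi> (?x n k) (?x (Suc n) (Suc (2 * k)))
              - \<Xi> (?x (Suc n) (Suc (2 * k))) (?x n (Suc k))"
  have e: "grid a b (Suc n) (Suc (Suc (2 * k))) = grid a b n (Suc k)" for k
    using grid_Suc_even[of a b n "Suc k"] by simp
  have diff: "grid_sum \<Xi> a b (Suc n) u v - grid_sum \<Xi> a b n u v = - (\<Sum>k<2 ^ n. ?D k)"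
    unfolding grid_sum_def power_Suc sum_dyadic_pairs e grid_Suc_even
    by (simp add: sum_subtractf sum.distrib algebra_simps)
  have "norm (\<Sum>k<2 ^ n. ?D k) \<le> (\<Sum>k<(2::nat) ^ n. c * ((b - a) / 2 ^ n) powr \<theta>)"
  proof (rule sum_norm_le)
    fix k
    have g1: "grid a b n k \<le> grid a b (Suc n) (Suc (2 * k))"
      using monoD[OF grid_mono[OF ab, of "Suc n"], of "2 * k" "Suc (2 * k)"] by (simp add: grid_Suc_even)
    have g2: "grid a b (Suc n) (Suc (2 * k)) \<le> grid a b n (Suc k)"
      using monoD[OF grid_mono[OF ab, of "Suc n"], of "Suc (2 * k)" "2 * Suc k"]
      by (simp only: grid_Suc_even) simp
    have "norm (?D k) \<le> c * (?x n (Suc k) - ?x n k) powr \<theta>"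
      using clip_bounds[OF assms(5), of "grid a b n k"] clip_bounds[OF assms(5), of "grid a b n (Suc k)"]
        assms(4,6) g1 g2
      by (intro defect_leD[OF assms(3)] clip_mono) linarith+
    also have "\<dots> \<le> c * ((b - a) / 2 ^ n) powr \<theta>"
      using clip_diff_le[of "grid a b n k" "grid a b n (Suc k)" u v] g1 g2 assms(1,2)
      by (intro mult_left_mono powr_mono2) (auto simp: grid_diff clip_mono)
    finally show "norm (?D k) \<le> c * ((b - a) / 2 ^ n) powr \<theta>" .
  qed
  also have "\<dots> = c * (b - a) powr \<theta> * (2 powr (1 - \<theta>)) ^ n"
    by (simp only: sum_constant card_lessThan mesh_sum_eq[OF ab])
  finally show ?thesis unfolding diff norm_minus_cancel .
qed

lemma grid_sum_convergent:
  fixes \<Xi> :: "real \<Rightarrow> real \<Rightarrow> 'v::banach"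
  assumes "1 < \<theta>" "0 \<le> c" "defect_le \<Xi> \<theta> c a b" "a \<le> u" "u \<le> v" "v \<le> b"
  shows "convergent (\<lambda>n. grid_sum \<Xi> a b n u v)"
proof -
  let ?S = "\<lambda>n. grid_sum \<Xi> a b n u v"
  have "summable (\<lambda>n. c * (b - a) powr \<theta> * (2 powr (1 - \<theta>)) ^ n)"
    using two_powr_less_1[OF assms(1)] by (intro summable_mult summable_geometric) auto
  hence "summable (\<lambda>n. ?S (Suc n) - ?S n)"
    by (rule summable_comparison_test[rotated]) (use grid_sum_refine[OF assms] in auto)
  hence "convergent (\<lambda>n. \<Sum>k<n. ?S (Suc k) - ?S k)"
    by (simp add: summable_iff_convergent)
  hence "convergent (\<lambda>n. ?S 0 + (?S n - ?S 0))"
    unfolding sum_lessThan_telescope[of ?S] by (intro convergent_add convergent_const)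
  thus ?thesis by simp
qed

text \<open>A cell that does not contain \<open>w\<close> contributes nothing. Bounding every cell by the defect
  estimate is crude but suffices, because there are $2^n$ cells of length of order $2^{-n}$
  and $\theta > 1$.\<close>
lemma grid_sum_defect:
  fixes \<Xi> :: "real \<Rightarrow> real \<Rightarrow> 'v::real_normed_vector"
  assumes "1 < \<theta>" "0 \<le> c" "defect_le \<Xi> \<theta> c a b" "a \<le> u" "u \<le> w" "w \<le> v" "v \<le> b"
  shows "norm (grid_sum \<Xi> a b n u v - grid_sum \<Xi> a b n u w - grid_sum \<Xi> a b n w v)
         \<le> c * (b - a) powr \<theta> * (2 powr (1 - \<theta>)) ^ n"
proof -
  let ?A = "\<lambda>k. clip u v (grid a b n k)"
  have ab: "a \<le> b" and uv: "u \<le> v" using assms(4-7) by linarith+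
  have sub: "clip u w x = min w (clip u v x)" "clip w v x = max w (clip u v x)" for x
    using assms(5,6) by (simp_all add: clip_def min_def max_def)
  let ?D = "\<lambda>k. \<Xi> (?A k) (?A (Suc k)) - \<Xi> (min w (?A k)) (min w (?A (Suc k)))
            - \<Xi> (max w (?A k)) (max w (?A (Suc k)))"
  have diff: "grid_sum \<Xi> a b n u v - grid_sum \<Xi> a b n u w - grid_sum \<Xi> a b n w v = (\<Sum>k<2 ^ n. ?D k)"
    by (simp add: grid_sum_def sum_subtractf sub)
  have "norm (\<Sum>k<2 ^ n. ?D k) \<le> (\<Sum>k<(2::nat) ^ n. c * ((b - a) / 2 ^ n) powr \<theta>)"
  proof (rule sum_norm_le)
    fix k
    have g: "grid a b n k \<le> grid a b n (Suc k)" using grid_mono[OF ab, of n] by (simp add: mono_def)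
    have A: "a \<le> ?A k" "?A k \<le> ?A (Suc k)" "?A (Suc k) \<le> b"
      using clip_bounds[OF uv, of "grid a b n k"] clip_bounds[OF uv, of "grid a b n (Suc k)"]
        clip_mono[OF g] assms(4,7) by auto
    have "norm (?D k) \<le> c * (?A (Suc k) - ?A k) powr \<theta>"
    proof (cases "?A k \<le> w \<and> w \<le> ?A (Suc k)")
      case True
      thus ?thesis using defect_leD[OF assms(3), of "?A k" w "?A (Suc k)"] A by (simp add: max_absorb2)
    next
      case False
      then consider "w < ?A k" "w < ?A (Suc k)" | "?A k < w" "?A (Suc k) < w" using A by linarith
      thus ?thesis
        using A(2) defect_le_diagonal[OF assms(3), of w] assms(2,4-7)
        by cases simp_all
    qed
    also have "\<dots> \<le> c * ((b - a) / 2 ^ n) powr \<theta>"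
      using clip_diff_le[OF g, of u v] A assms(1,2)
      by (intro mult_left_mono powr_mono2) (auto simp: grid_diff)
    finally show "norm (?D k) \<le> c * ((b - a) / 2 ^ n) powr \<theta>" .
  qed
  also have "\<dots> = c * (b - a) powr \<theta> * (2 powr (1 - \<theta>)) ^ n"
    by (simp only: sum_constant card_lessThan mesh_sum_eq[OF ab])
  finally show ?thesis unfolding diff .
qed

lemma grid_sum_near_germ:
  fixes \<Xi> :: "real \<Rightarrow> real \<Rightarrow> 'v::real_normed_vector"
  assumes "1 < \<theta>" "0 \<le> c" "a \<le> u" "u \<le> v" "v \<le> b" "defect_le \<Xi> \<theta> c u v"
  shows "norm (grid_sum \<Xi> a b n u v - \<Xi> u v) \<le> sewing_const \<theta> * c * (v - u) powr \<theta>"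
proof -
  let ?x = "\<lambda>k. clip u v (grid a b n k)"
  have "mono ?x" using grid_mono[of a b n] assms by (simp add: mono_def clip_mono)
  moreover have "?x 0 = u" "?x (2 ^ n) = v" using assms by (simp_all add: clip_def grid_def)
  ultimately show ?thesis
    using bisection_sum_bound[OF assms(1,2), of ?x 0 "2 ^ n" \<Xi>] assms(6)
    by (simp add: grid_sum_def atLeast0LessThan)
qed

text \<open>An additive \<open>I\<close> is obtained once for the whole interval, while the distance to the germ on
  \<open>[u, v]\<close> is measured with any constant \<open>c'\<close> that is valid on \<open>[u, v]\<close> alone.\<close>
theorem sewing:
  fixes \<Xi> :: "real \<Rightarrow> real \<Rightarrow> 'v::banach"
  assumes "1 < \<theta>" "0 \<le> c" "defect_le \<Xi> \<theta> c a b"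
  shows "\<exists>I. (\<forall>u w v. a \<le> u \<and> u \<le> w \<and> w \<le> v \<and> v \<le> b \<longrightarrow> I u v = I u w + I w v) \<and>
    (\<forall>u v c'. a \<le> u \<and> u \<le> v \<and> v \<le> b \<and> 0 \<le> c' \<and> defect_le \<Xi> \<theta> c' u v \<longrightarrow>
       norm (I u v - \<Xi> u v) \<le> sewing_const \<theta> * c' * (v - u) powr \<theta>)"
proof -
  let ?S = "\<lambda>u v n. grid_sum \<Xi> a b n u v"
  define I where "I u v = lim (?S u v)" for u v
  have lim: "?S u v \<longlonglongrightarrow> I u v" if "a \<le> u" "u \<le> v" "v \<le> b" for u v
    using grid_sum_convergent[OF assms that] by (simp add: convergent_LIMSEQ_iff I_def)
  have "I u v = I u w + I w v" if o: "a \<le> u" "u \<le> w" "w \<le> v" "v \<le> b" for u w v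
  proof -
    have "(\<lambda>n. c * (b - a) powr \<theta> * (2 powr (1 - \<theta>)) ^ n) \<longlonglongrightarrow> c * (b - a) powr \<theta> * 0"
      using two_powr_less_1[OF assms(1)] by (intro tendsto_mult tendsto_const LIMSEQ_power_zero) auto
    hence "(\<lambda>n. c * (b - a) powr \<theta> * (2 powr (1 - \<theta>)) ^ n) \<longlonglongrightarrow> 0" by simp
    hence "(\<lambda>n. ?S u v n - ?S u w n - ?S w v n) \<longlonglongrightarrow> 0"
      by (rule Lim_null_comparison[rotated]) (intro always_eventually allI grid_sum_defect[OF assms o])
    moreover have "(\<lambda>n. ?S u v n - ?S u w n - ?S w v n) \<longlonglongrightarrow> I u v - I u w - I w v"
      using o order_trans[OF o(1,2)] order_trans[OF o(3,4)] order_trans[OF o(2,3)]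
      by (intro tendsto_diff lim)
    ultimately have "I u v - I u w - I w v = 0" by (rule LIMSEQ_unique[rotated])
    thus ?thesis by (simp add: algebra_simps)
  qed
  moreover have "norm (I u v - \<Xi> u v) \<le> sewing_const \<theta> * c' * (v - u) powr \<theta>"
    if o: "a \<le> u" "u \<le> v" "v \<le> b" "0 \<le> c'" "defect_le \<Xi> \<theta> c' u v" for u v c'
    using Lim_norm_ubound[OF trivial_limit_sequentially tendsto_diff[OF lim[OF o(1-3)] tendsto_const]
        always_eventually[OF allI[OF grid_sum_near_germ[OF assms(1) o(4,1,2,3,5)]]]] .
  ultimately show ?thesis by (intro exI[of _ I]) blast
qed

section \<open>Limits of sums over fine divisions\<close>

lemma eventually_fine_divisions:
  "eventually Q (fine_divisions s t) \<longleftrightarrow>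
     (\<exists>\<delta>>0. \<forall>P. P division_of {s..t} \<and> (\<forall>K\<in>P. diameter K < \<delta>) \<longrightarrow> Q P)"
proof -
  let ?F = "\<lambda>\<delta>::real. principal {P. P division_of {s..t} \<and> (\<forall>K\<in>P. diameter K < \<delta>)}"
  have "eventually Q (fine_divisions s t) \<longleftrightarrow> (\<exists>\<delta>\<in>{0<..}. eventually Q (?F \<delta>))"
    unfolding fine_divisions_def
  proof (rule eventually_INF_base)
    fix x y :: real assume "x \<in> {0<..}" "y \<in> {0<..}"
    thus "\<exists>z\<in>{0<..}. ?F z \<le> inf (?F x) (?F y)"
      by (intro bexI[of _ "min x y"]) (simp_all add: Collect_mono_iff)
  qed (simp add: gt_ex)
  thus ?thesis by (simp add: eventually_principal Bex_def)
qed

text \<open>Only along a proper filter does \<^const>\<open>Lim\<close> return the limit; Cousin's lemma provides the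
  divisions.\<close>
lemma fine_divisions_neq_bot:
  assumes "s \<le> t"
  shows "fine_divisions s t \<noteq> bot"
proof
  assume "fine_divisions s t = bot"
  hence "eventually (\<lambda>_. False) (fine_divisions s t)" by simp
  then obtain \<delta> where \<delta>: "\<delta> > 0" "\<And>P. P division_of {s..t} \<Longrightarrow> \<not> (\<forall>K\<in>P. diameter K < \<delta>)"
    unfolding eventually_fine_divisions by blast
  have "gauge (\<lambda>x. ball x (\<delta> / 4))" using \<delta>(1) by (simp add: gauge_ball)
  then obtain p where p: "p tagged_division_of {s..t}" "(\<lambda>x. ball x (\<delta> / 4)) fine p"
    by (rule fine_division_exists_real)
  have "diameter K < \<delta>" if K: "K \<in> snd ` p" for K
  proof -
    obtain x where "(x, K) \<in> p" using K by auto
    hence "K \<subseteq> ball x (\<delta> / 4)" by (rule fineD[OF p(2)])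
    hence "diameter K \<le> diameter (ball x (\<delta> / 4))" by (rule diameter_subset) simp
    also have "\<dots> < \<delta>" using \<delta>(1) by (simp add: diameter_ball)
    finally show ?thesis .
  qed
  thus False using \<delta>(2)[OF division_of_tagged_division[OF p(1)]] by simp
qed

lemma division_cell:
  fixes P :: "real set set"
  assumes "P division_of {s..t}" "K \<in> P"
  obtains u v where "K = {u..v}" "s \<le> u" "u \<le> v" "v \<le> t"
proof -
  obtain u v where "K = {u..v}" "K \<noteq> {}" "K \<subseteq> {s..t}"
    using division_ofD(2-4)[OF assms] by (metis interval_cbox)
  thus ?thesis using that[of u v] by simp
qed

lemma additive_sum_division:
  fixes I :: "real \<Rightarrow> real \<Rightarrow> 'v::real_normed_vector"
  assumes P: "P division_of {s..t}" and "s \<le> t"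
    and add: "\<And>u v. s \<le> u \<Longrightarrow> u \<le> v \<Longrightarrow> v \<le> t \<Longrightarrow> I s v = I s u + I u v"
  shows "(\<Sum>K\<in>P. I (Inf K) (Sup K)) = I s t"
proof -
  \<comment> \<open>Tagging each cell by its left end point makes the telescoping sum for tagged divisions apply.\<close>
  let ?p = "(\<lambda>K. (Inf K, K)) ` P"
  have "?p tagged_division_of {s..t}"
  proof (rule tagged_division_ofI)
    show "finite ?p" using P by (simp add: division_of_finite)
    fix x K assume "(x, K) \<in> ?p"
    hence K: "K \<in> P" "x = Inf K" by auto
    obtain u v where uv: "K = {u..v}" "s \<le> u" "u \<le> v" "v \<le> t"
      by (rule division_cell[OF P K(1)])
    show "x \<in> K" "K \<subseteq> {s..t}" using K(2) uv by simp_all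
    show "\<exists>a b. K = cbox a b" using uv(1) by (metis interval_cbox)
  next
    fix x1 K1 x2 K2
    assume "(x1, K1) \<in> ?p" "(x2, K2) \<in> ?p" "(x1, K1) \<noteq> (x2, K2)"
    thus "interior K1 \<inter> interior K2 = {}" using division_ofD(5)[OF P] by blast
  next
    have "{K. \<exists>x. (x, K) \<in> ?p} = P" by auto
    thus "\<Union>{K. \<exists>x. (x, K) \<in> ?p} = {s..t}" using division_ofD(6)[OF P] by simp
  qed
  from additive_tagged_division_1[OF \<open>s \<le> t\<close> this, of "I s"]
  have "(\<Sum>K\<in>P. I s (Sup K) - I s (Inf K)) = I s t - I s s"
    by (subst (asm) sum.reindex) (auto simp: inj_on_def)
  moreover have "I s s = 0" using add[of s s] \<open>s \<le> t\<close> by simp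
  moreover have "I s (Sup K) - I s (Inf K) = I (Inf K) (Sup K)" if K: "K \<in> P" for K
  proof -
    obtain u v where "K = {u..v}" "s \<le> u" "u \<le> v" "v \<le> t" by (rule division_cell[OF P K])
    thus ?thesis using add[of u v] by simp
  qed
  ultimately show ?thesis by simp
qed

text \<open>Over any division the sums of the additive function \<open>I\<close> telescope, so only the cellwise
  errors matter, and $\sum |v-u|^\theta \le \delta^{\theta-1}(t-s)$ for mesh $\delta$. No comparison of
  two different divisions is needed.\<close>
lemma additive_limit_of_division_sums:
  fixes \<Xi> I :: "real \<Rightarrow> real \<Rightarrow> 'v::real_normed_vector"
  assumes "1 < \<theta>" "s \<le> t"
    and add: "\<And>u v. s \<le> u \<Longrightarrow> u \<le> v \<Longrightarrow> v \<le> t \<Longrightarrow> I s v = I s u + I u v"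
    and near: "\<And>u v. s \<le> u \<Longrightarrow> u \<le> v \<Longrightarrow> v \<le> t \<Longrightarrow> norm (I u v - \<Xi> u v) \<le> M * (v - u) powr \<theta>"
  shows "((\<lambda>P. \<Sum>K\<in>P. \<Xi> (Inf K) (Sup K)) \<longlongrightarrow> I s t) (fine_divisions s t)"
proof (rule tendstoI)
  fix e :: real assume "0 < e"
  define N where "N = \<bar>M\<bar> * (t - s) + 1"
  have N: "0 < N" "\<bar>M\<bar> * (t - s) < N" using assms(2) by (auto simp: N_def intro: add_nonneg_pos)
  \<comment> \<open>The mesh for which $|M| \delta^{\theta-1} (t-s) < e$; the summand 1 keeps \<open>N\<close> positive.\<close>
  define \<delta> where "\<delta> = (e / N) powr (1 / (\<theta> - 1))"
  have \<delta>: "0 < \<delta>" "\<delta> powr (\<theta> - 1) = e / N"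
    using \<open>0 < e\<close> N(1) assms(1) by (auto simp: \<delta>_def powr_powr)
  have "dist (\<Sum>K\<in>P. \<Xi> (Inf K) (Sup K)) (I s t) < e"
    if P: "P division_of {s..t}" and fine: "\<forall>K\<in>P. diameter K < \<delta>" for P
  proof -
    have "dist (\<Sum>K\<in>P. \<Xi> (Inf K) (Sup K)) (I s t)
        = norm (\<Sum>K\<in>P. I (Inf K) (Sup K) - \<Xi> (Inf K) (Sup K))"
      using additive_sum_division[of P s t I, OF P assms(2) add]
      by (simp add: dist_norm sum_subtractf norm_minus_commute)
    also have "\<dots> \<le> (\<Sum>K\<in>P. \<bar>M\<bar> * (e / N) * measure lborel K)"
    proof (rule sum_norm_le)
      fix K assume K: "K \<in> P"
      obtain u v where o: "K = {u..v}" "s \<le> u" "u \<le> v" "v \<le> t" by (rule division_cell[OF P K])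
      define l where "l = v - u"
      have cl: "measure lborel K = l" and l: "0 \<le> l" "l < \<delta>"
        using o(1,3) fine K by (auto simp: l_def)
      have "norm (I (Inf K) (Sup K) - \<Xi> (Inf K) (Sup K)) \<le> M * l powr \<theta>"
        unfolding l_def using near[OF o(2-4)] o(1,3) by simp
      also have "\<dots> \<le> \<bar>M\<bar> * l powr \<theta>" by (intro mult_right_mono) auto
      also have "l powr \<theta> = l powr (\<theta> - 1) * l"
        using l(1) powr_add[of l "\<theta> - 1" 1] by simp
      also have "\<bar>M\<bar> * (l powr (\<theta> - 1) * l) \<le> \<bar>M\<bar> * (\<delta> powr (\<theta> - 1) * l)"
        using l assms(1) by (intro mult_left_mono mult_right_mono powr_mono2) auto
      finally show "norm (I (Inf K) (Sup K) - \<Xi> (Inf K) (Sup K)) \<le> \<bar>M\<bar> * (e / N) * measure lborel K"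
        by (simp add: \<delta>(2) cl mult.assoc)
    qed
    also have "\<dots> = \<bar>M\<bar> * (e / N) * (\<Sum>K\<in>P. measure lborel K)"
      by (simp only: sum_distrib_left)
    also have "\<dots> = \<bar>M\<bar> * (t - s) * (e / N)"
      using additive_content_division[of P s t] P assms(2) by simp
    also have "\<dots> < N * (e / N)"
      using N \<open>0 < e\<close> by (intro mult_strict_right_mono) auto
    finally show ?thesis using N(1) by simp
  qed
  thus "eventually (\<lambda>P. dist (\<Sum>K\<in>P. \<Xi> (Inf K) (Sup K)) (I s t) < e) (fine_divisions s t)"
    unfolding eventually_fine_divisions using \<delta>(1) by blast
qed

section \<open>The compensated germ of a scalar integral\<close>

text \<open>The pairing $(A \diamond B)\,M$ for scalar-valued $A$ and $B$.\<close>
definition area :: "((real ^ 'd) \<Rightarrow>\<^sub>L real) \<Rightarrow> ((real ^ 'd) \<Rightarrow>\<^sub>L real) \<Rightarrow> real ^ 'd ^ 'd \<Rightarrow> real" where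
  "area A B M = (\<Sum>i\<in>UNIV. \<Sum>j\<in>UNIV. M $ i $ j * (A (axis i 1) * B (axis j 1)))"

lemma area_add_matrix: "area A B (M + N) = area A B M + area A B N"
  by (simp add: area_def distrib_right sum.distrib)

lemma area_diff_left: "area (A - A') B M = area A B M - area A' B M"
  by (simp add: area_def blinfun.diff_left left_diff_distrib right_diff_distrib sum_subtractf)

lemma area_diff_right: "area A (B - B') M = area A B M - area A B' M"
  by (simp add: area_def blinfun.diff_left right_diff_distrib sum_subtractf)

lemma blinfun_cart_expansion:
  fixes A :: "(real ^ 'd) \<Rightarrow>\<^sub>L real"
  shows "blinfun_apply A x = (\<Sum>i\<in>UNIV. x $ i * blinfun_apply A (axis i 1))"
proof -
  have "blinfun_apply A x = blinfun_apply A (\<Sum>i\<in>UNIV. x $ i *\<^sub>R axis i 1)"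
    by (simp add: basis_expansion flip: scalar_mult_eq_scaleR)
  thus ?thesis by (simp add: blinfun.sum_right blinfun.scaleR_right)
qed

lemma area_tensor: "area A B (tensor x y) = blinfun_apply A x * blinfun_apply B y"
  unfolding blinfun_cart_expansion[of A x] blinfun_cart_expansion[of B y]
  by (simp add: area_def tensor_def sum_product mult_ac)

lemma abs_area_le:
  fixes M :: "real ^ 'd ^ 'd"
  shows "\<bar>area A B M\<bar> \<le> (real CARD('d))\<^sup>2 * (norm A * norm B * norm M)"
proof -
  have "\<bar>M $ i $ j * (A (axis i 1) * B (axis j 1))\<bar> \<le> norm A * norm B * norm M" for i j
  proof -
    have "\<bar>M $ i $ j\<bar> \<le> norm M"
      using component_le_norm_cart[of "M $ i" j] Finite_Cartesian_Product.norm_nth_le[of M i] by linarith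
    moreover have "\<bar>A (axis i 1)\<bar> \<le> norm A" "\<bar>B (axis j 1)\<bar> \<le> norm B"
      using norm_blinfun[of A "axis i 1"] norm_blinfun[of B "axis j 1"] by simp_all
    ultimately show ?thesis
      unfolding abs_mult mult.commute[of "norm A * norm B"] by (intro mult_mono) auto
  qed
  hence "\<bar>area A B M\<bar> \<le> (\<Sum>i\<in>(UNIV::'d set). \<Sum>j\<in>(UNIV::'d set). norm A * norm B * norm M)"
    unfolding area_def by (intro order_trans[OF sum_abs] sum_mono order_trans[OF sum_abs])
  thus ?thesis by (simp add: power2_eq_square mult.assoc)
qed

definition germ ::
    "(real \<Rightarrow> real \<Rightarrow> real ^ 'd ^ 'd) \<Rightarrow> 'd::finite cpath \<Rightarrow> 'd cpath \<Rightarrow> real \<Rightarrow> real \<Rightarrow> real" where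
  "germ XX y w u v = fst y u * (fst w v - fst w u) + area (snd y u) (snd w u) (XX u v)"

lemma cintegral_germ:
  "fst (cintegral XX s y w) r = Lim (fine_divisions s r) (\<lambda>P. \<Sum>K\<in>P. germ XX y w (Inf K) (Sup K))"
  by (simp add: cintegral_def rough_integral_def germ_def Let_def diamond_def area_def
      bounded_linear_Blinfun_apply[OF bounded_linear_blinfun_mult_right])

section \<open>Graded families of controlled paths\<close>

text \<open>Working with powers $((v-u)^\alpha)^n$ for natural \<open>n\<close> has the convention $0^0 = 1$ built in.\<close>
definition hgap :: "real \<Rightarrow> real \<Rightarrow> real \<Rightarrow> real" where
  "hgap \<alpha> u v = (v - u) powr \<alpha>"

definition cmult :: "'d::finite cpath \<Rightarrow> 'd cpath \<Rightarrow> 'd cpath" where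
  "cmult y z = (\<lambda>r. fst y r * fst z r, \<lambda>r. fst z r *\<^sub>R snd y r + fst y r *\<^sub>R snd z r)"

text \<open>Real bounds replace the extended-valued seminorms, and they include degenerate intervals, on which
  Chen's relation makes \<open>XX\<close> vanish.\<close>
locale rough_setting =
  fixes \<alpha> T K :: real
    and X :: "real \<Rightarrow> real ^ 'd" and XX :: "real \<Rightarrow> real \<Rightarrow> real ^ 'd ^ 'd"
  assumes alpha: "1 / 3 < \<alpha>" and T: "0 < T" and K: "0 \<le> K"
    and X_bound: "\<And>u v. 0 \<le> u \<Longrightarrow> u \<le> v \<Longrightarrow> v \<le> T \<Longrightarrow> norm (X v - X u) \<le> K * hgap \<alpha> u v"
    and XX_bound: "\<And>u v. 0 \<le> u \<Longrightarrow> u \<le> v \<Longrightarrow> v \<le> T \<Longrightarrow> norm (XX u v) \<le> K * hgap \<alpha> u v ^ 2"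
    and chen: "\<And>s u t. 0 \<le> s \<Longrightarrow> s \<le> u \<Longrightarrow> u \<le> t \<Longrightarrow> t \<le> T \<Longrightarrow>
        XX s t = XX s u + XX u t + tensor (X u - X s) (X t - X u)"
begin

abbreviation d :: "real \<Rightarrow> real \<Rightarrow> real" where "d \<equiv> hgap \<alpha>"

definition B :: real where "B = 1 + T powr \<alpha>"

lemma B_ge_1: "1 \<le> B" by (simp add: B_def)

lemma d_nonneg [simp]: "0 \<le> d u v" by (simp add: hgap_def)

lemma d_self [simp]: "d u u = 0" using alpha by (simp add: hgap_def)

lemma d_mono: "u' \<le> u \<Longrightarrow> u \<le> v \<Longrightarrow> v \<le> v' \<Longrightarrow> d u v \<le> d u' v'"
  unfolding hgap_def using alpha by (intro powr_mono2) auto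

lemma d_le_B: "0 \<le> u \<Longrightarrow> u \<le> v \<Longrightarrow> v \<le> T \<Longrightarrow> d u v \<le> B"
  using d_mono[of 0 u v T] by (simp add: B_def hgap_def)

text \<open>Truncated exponents such as \<open>n - 2\<close> are not additive, so products of estimates produce
  exponents that are too large by up to 2. Since all lengths are bounded, the surplus costs only
  the constant \<open>B\<^sup>2\<close>.\<close>
lemma power_lower_exponent:
  assumes "0 \<le> x" "x \<le> B" "e \<le> a" "a \<le> e + 2"
  shows "x ^ a \<le> B\<^sup>2 * x ^ e"
proof -
  have "x ^ a = x ^ (a - e) * x ^ e" using assms(3) by (simp flip: power_add)
  also have "x ^ (a - e) \<le> B ^ (a - e)" using assms by (intro power_mono) auto
  also have "B ^ (a - e) \<le> B\<^sup>2" using assms(4) B_ge_1 by (intro power_increasing) auto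
  finally show ?thesis using assms(1) by (simp add: mult_right_mono)
qed

text \<open>The bookkeeping rule behind all estimates below: \<open>q\<close> measures the distance to the base point,
  \<open>h\<close> the length of the increment.\<close>
lemma mult_order_bound:
  assumes "f \<le> C * q ^ a * h ^ i" "g \<le> C' * q ^ b * h ^ j" "0 \<le> f" "0 \<le> g"
    and "0 \<le> C" "0 \<le> C'" "0 \<le> h" "0 \<le> q" "q \<le> B"
    and "e \<le> a + b" "a + b \<le> e + 2" "i + j = m"
  shows "f * g \<le> C * C' * B\<^sup>2 * q ^ e * h ^ m"
proof -
  have "f * g \<le> (C * q ^ a * h ^ i) * (C' * q ^ b * h ^ j)"
    using assms by (intro mult_mono) auto
  also have "\<dots> = C * C' * q ^ (a + b) * h ^ m"
    using assms(12) by (simp add: power_add mult_ac flip: assms(12))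
  also have "\<dots> \<le> C * C' * (B\<^sup>2 * q ^ e) * h ^ m"
    using assms by (intro mult_right_mono mult_left_mono power_lower_exponent) auto
  finally show ?thesis by (simp add: mult.assoc)
qed

text \<open>The claim of the theorem for a family \<open>y s\<close> of scalar controlled paths started at \<open>s\<close>, with
  \<open>n\<close> in the role of the number of vertices. The truncated subtraction \<open>n - 2\<close> is the positive part
  $(n-2)_+$, and \<open>n - 1\<close> differs from the exponent of the theorem only for \<open>n = 0\<close>, where the
  derivative is required to be bounded. Grade 0 for a constant family is ordinary controlledness, so
  the driver and the empty forest are covered by the same notion. The constant does not depend on \<open>s\<close>.\<close>
definition graded_with :: "real \<Rightarrow> nat \<Rightarrow> (real \<Rightarrow> 'd cpath) \<Rightarrow> bool" where
  "graded_with C n y \<longleftrightarrow> 0 \<le> C \<and> (\<forall>s u v. 0 \<le> s \<and> s \<le> u \<and> u \<le> v \<and> v \<le> T \<longrightarrow>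
     \<bar>fst (y s) u\<bar> \<le> C * d s u ^ n \<and>
     norm (snd (y s) u) \<le> C * d s u ^ (n - 1) \<and>
     norm (snd (y s) v - snd (y s) u) \<le> C * d s v ^ (n - 2) * d u v \<and>
     \<bar>remainder X (fst (y s)) (snd (y s)) u v\<bar> \<le> C * d s v ^ (n - 2) * (d u v)\<^sup>2)"

definition graded :: "nat \<Rightarrow> (real \<Rightarrow> 'd cpath) \<Rightarrow> bool" where
  "graded n y \<longleftrightarrow> (\<exists>C. graded_with C n y)"

lemma graded_withD:
  assumes "graded_with C n y" "0 \<le> s" "s \<le> u" "u \<le> v" "v \<le> T"
  shows "0 \<le> C"
    and "\<bar>fst (y s) u\<bar> \<le> C * d s u ^ n"
    and "norm (snd (y s) u) \<le> C * d s u ^ (n - 1)"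
    and "norm (snd (y s) v - snd (y s) u) \<le> C * d s v ^ (n - 2) * d u v"
    and "\<bar>remainder X (fst (y s)) (snd (y s)) u v\<bar> \<le> C * d s v ^ (n - 2) * (d u v)\<^sup>2"
  using assms unfolding graded_with_def by blast+

text \<open>The four estimates may come with different constants of any sign.\<close>
lemma gradedI:
  assumes "\<And>s u. 0 \<le> s \<Longrightarrow> s \<le> u \<Longrightarrow> u \<le> T \<Longrightarrow> \<bar>fst (y s) u\<bar> \<le> C1 * d s u ^ n"
    and "\<And>s u. 0 \<le> s \<Longrightarrow> s \<le> u \<Longrightarrow> u \<le> T \<Longrightarrow> norm (snd (y s) u) \<le> C2 * d s u ^ (n - 1)"
    and "\<And>s u v. 0 \<le> s \<Longrightarrow> s \<le> u \<Longrightarrow> u \<le> v \<Longrightarrow> v \<le> T \<Longrightarrow>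
      norm (snd (y s) v - snd (y s) u) \<le> C3 * d s v ^ (n - 2) * d u v"
    and "\<And>s u v. 0 \<le> s \<Longrightarrow> s \<le> u \<Longrightarrow> u \<le> v \<Longrightarrow> v \<le> T \<Longrightarrow>
      \<bar>remainder X (fst (y s)) (snd (y s)) u v\<bar> \<le> C4 * d s v ^ (n - 2) * (d u v)\<^sup>2"
  shows "graded n y"
proof -
  let ?C = "\<bar>C1\<bar> + \<bar>C2\<bar> + \<bar>C3\<bar> + \<bar>C4\<bar>"
  have "C1 \<le> ?C" "C2 \<le> ?C" "C3 \<le> ?C" "C4 \<le> ?C" by auto
  hence le: "C1 * x \<le> ?C * x" "C2 * x \<le> ?C * x" "C3 * x * z \<le> ?C * x * z" "C4 * x * z \<le> ?C * x * z"
    if "0 \<le> x" "0 \<le> z" for x z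
    using that by (auto intro!: mult_right_mono)
  have "graded_with ?C n y"
    unfolding graded_with_def
  proof (intro conjI allI impI, goal_cases)
    case (2 s u v) thus ?case using assms(1)[of s u] le(1)[of "d s u ^ n" 0] by simp
  next
    case (3 s u v) thus ?case using assms(2)[of s u] le(2)[of "d s u ^ (n - 1)" 0] by simp
  next
    case (4 s u v) thus ?case using assms(3)[of s u v] le(3)[of "d s v ^ (n - 2)" "d u v"] by simp
  next
    case (5 s u v)
    thus ?case using assms(4)[of s u v] le(4)[of "d s v ^ (n - 2)" "(d u v)\<^sup>2"] by simp
  qed auto
  thus ?thesis unfolding graded_def by blast
qed

text \<open>The increment is the remainder plus the derivative applied to the increment of \<open>X\<close>; one of the
  two factors \<open>d u v\<close> in the remainder estimate is traded for \<open>d s v\<close>.\<close>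
lemma graded_with_increment:
  assumes y: "graded_with C n y" and o: "0 \<le> s" "s \<le> u" "u \<le> v" "v \<le> T"
  shows "\<bar>fst (y s) v - fst (y s) u\<bar> \<le> C * (B\<^sup>2 + K) * d s v ^ (n - 1) * d u v"
proof -
  note y = graded_withD[OF y o]
  have pq: "d s u \<le> d s v" "d u v \<le> d s v" using o by (auto intro: d_mono)
  have "d s v ^ (n - 2) * (d u v)\<^sup>2 \<le> d s v ^ (n - 2 + 1) * d u v"
    unfolding power2_eq_square power_add power_one_right mult.assoc
    by (intro mult_left_mono mult_right_mono pq) auto
  also have "\<dots> \<le> B\<^sup>2 * d s v ^ (n - 1) * d u v"
    using d_le_B[of s v] o by (intro mult_right_mono power_lower_exponent) auto
  finally have "C * (d s v ^ (n - 2) * (d u v)\<^sup>2) \<le> C * (B\<^sup>2 * d s v ^ (n - 1) * d u v)"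
    using y(1) by (rule mult_left_mono)
  hence rem: "\<bar>remainder X (fst (y s)) (snd (y s)) u v\<bar> \<le> C * B\<^sup>2 * d s v ^ (n - 1) * d u v"
    using y(5) by (simp add: mult.assoc)
  have "C * d s u ^ (n - 1) \<le> C * d s v ^ (n - 1)"
    using pq y(1) by (intro mult_left_mono power_mono) auto
  hence "norm (snd (y s) u) * norm (X v - X u) \<le> (C * d s v ^ (n - 1)) * (K * d u v)"
    using y(1,3) X_bound[of u v] o K by (intro mult_mono) auto
  hence "\<bar>snd (y s) u (X v - X u)\<bar> \<le> (C * d s v ^ (n - 1)) * (K * d u v)"
    using norm_blinfun[of "snd (y s) u" "X v - X u"] by simp
  moreover have "fst (y s) v - fst (y s) u
      = remainder X (fst (y s)) (snd (y s)) u v + snd (y s) u (X v - X u)"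
    by (simp add: remainder_def)
  ultimately show ?thesis using rem by (simp add: algebra_simps)
qed

text \<open>Grades add under products: in the Leibniz expansions of the derivative and of the remainder,
  every term is a product of one estimate for \<open>y\<close> and one for \<open>z\<close>.\<close>
lemma graded_cmult:
  assumes "graded n y" "graded k z"
  shows "graded (n + k) (\<lambda>s. cmult (y s) (z s))"
proof -
  obtain C C' where y: "graded_with C n y" and z: "graded_with C' k z"
    using assms unfolding graded_def by blast
  define E where "E = C * (B\<^sup>2 + K)"
  define E' where "E' = C' * (B\<^sup>2 + K)"
  have nonneg: "0 \<le> C" "0 \<le> C'" using y z by (auto simp: graded_with_def)
  hence E: "0 \<le> E" "0 \<le> E'" using K by (auto simp: E_def E'_def)
  show ?thesis
  proof (rule gradedI)
    fix s u :: real assume o: "0 \<le> s" "s \<le> u" "u \<le> T"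
    note Y = graded_withD[OF y o(1,2) order_refl o(3)] and Z = graded_withD[OF z o(1,2) order_refl o(3)]
    have q: "0 \<le> d s u" "d s u \<le> B" using d_le_B o by auto
    have yu: "\<bar>fst (y s) u\<bar> \<le> C * d s u ^ n * 0 ^ 0" "norm (snd (y s) u) \<le> C * d s u ^ (n - 1) * 0 ^ 0"
      and zu: "\<bar>fst (z s) u\<bar> \<le> C' * d s u ^ k * 0 ^ 0" "norm (snd (z s) u) \<le> C' * d s u ^ (k - 1) * 0 ^ 0"
      using Y(2,3) Z(2,3) by simp_all
    have "\<bar>fst (y s) u\<bar> * \<bar>fst (z s) u\<bar> \<le> C * C' * B\<^sup>2 * d s u ^ (n + k) * 0 ^ 0"
      by (rule mult_order_bound[OF yu(1) zu(1)]) (use q nonneg in simp_all)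
    thus "\<bar>fst (cmult (y s) (z s)) u\<bar> \<le> C * C' * B\<^sup>2 * d s u ^ (n + k)"
      by (simp add: cmult_def abs_mult)
    have 1: "\<bar>fst (z s) u\<bar> * norm (snd (y s) u) \<le> C' * C * B\<^sup>2 * d s u ^ (n + k - 1) * 0 ^ 0"
      by (rule mult_order_bound[OF zu(1) yu(2)]) (use q nonneg in simp_all)
    have 2: "\<bar>fst (y s) u\<bar> * norm (snd (z s) u) \<le> C * C' * B\<^sup>2 * d s u ^ (n + k - 1) * 0 ^ 0"
      by (rule mult_order_bound[OF yu(1) zu(2)]) (use q nonneg in simp_all)
    show "norm (snd (cmult (y s) (z s)) u) \<le> (2 * C * C' * B\<^sup>2) * d s u ^ (n + k - 1)"
      using 1 2 norm_triangle_ineq[of "fst (z s) u *\<^sub>R snd (y s) u" "fst (y s) u *\<^sub>R snd (z s) u"]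
      by (simp add: cmult_def mult.commute[of C'])
  next
    fix s u v :: real assume o: "0 \<le> s" "s \<le> u" "u \<le> v" "v \<le> T"
    have sv: "s \<le> v" using o by auto
    note Y = graded_withD[OF y o] and Z = graded_withD[OF z o]
    define q where "q = d s v"
    define h where "h = d u v"
    have q: "0 \<le> q" "q \<le> B" "0 \<le> h" "d s u ^ i \<le> q ^ i" for i
      using d_le_B[of s v] o by (auto simp: q_def h_def intro!: power_mono d_mono)
    have "\<bar>fst (y s) u\<bar> \<le> C * q ^ n" "norm (snd (y s) u) \<le> C * q ^ (n - 1)"
      and "\<bar>fst (z s) u\<bar> \<le> C' * q ^ k" "norm (snd (z s) u) \<le> C' * q ^ (k - 1)"
      using Y(2,3) Z(2,3) nonneg q(4) by (meson mult_left_mono order_trans)+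
    hence Yu: "\<bar>fst (y s) u\<bar> \<le> C * q ^ n * h ^ 0" "norm (snd (y s) u) \<le> C * q ^ (n - 1) * h ^ 0"
      and Zu: "\<bar>fst (z s) u\<bar> \<le> C' * q ^ k * h ^ 0" "norm (snd (z s) u) \<le> C' * q ^ (k - 1) * h ^ 0"
      by simp_all
    have Yv: "\<bar>fst (y s) v\<bar> \<le> C * q ^ n * h ^ 0" and Zv: "\<bar>fst (z s) v\<bar> \<le> C' * q ^ k * h ^ 0"
      using graded_withD(2)[OF y o(1) sv order_refl o(4)] graded_withD(2)[OF z o(1) sv order_refl o(4)]
      by (simp_all add: q_def)
    have dY': "norm (snd (y s) v - snd (y s) u) \<le> C * q ^ (n - 2) * h ^ 1"
      and dZ': "norm (snd (z s) v - snd (z s) u) \<le> C' * q ^ (k - 2) * h ^ 1"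
      using Y(4) Z(4) by (simp_all add: q_def h_def)
    let ?Ry = "remainder X (fst (y s)) (snd (y s)) u v" and ?Rz = "remainder X (fst (z s)) (snd (z s)) u v"
    have RY: "\<bar>?Ry\<bar> \<le> C * q ^ (n - 2) * h ^ 2" and RZ: "\<bar>?Rz\<bar> \<le> C' * q ^ (k - 2) * h ^ 2"
      using Y(5) Z(5) by (simp_all add: q_def h_def)
    have dY: "\<bar>fst (y s) v - fst (y s) u\<bar> \<le> E * q ^ (n - 1) * h ^ 1"
      and dZ: "\<bar>fst (z s) v - fst (z s) u\<bar> \<le> E' * q ^ (k - 1) * h ^ 1"
      using graded_with_increment[OF y o] graded_with_increment[OF z o]
      by (simp_all add: E_def E'_def q_def h_def)
    have "norm (snd (y s) v - snd (y s) u) * \<bar>fst (z s) v\<bar> \<le> C * C' * B\<^sup>2 * q ^ (n + k - 2) * h ^ 1"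
      by (rule mult_order_bound[OF dY' Zv]) (use q nonneg E in simp_all)
    moreover have "norm (snd (y s) u) * \<bar>fst (z s) v - fst (z s) u\<bar>
        \<le> C * E' * B\<^sup>2 * q ^ (n + k - 2) * h ^ 1"
      by (rule mult_order_bound[OF Yu(2) dZ]) (use q nonneg E in simp_all)
    moreover have "norm (snd (z s) v - snd (z s) u) * \<bar>fst (y s) v\<bar>
        \<le> C' * C * B\<^sup>2 * q ^ (n + k - 2) * h ^ 1"
      by (rule mult_order_bound[OF dZ' Yv]) (use q nonneg E in simp_all)
    moreover have "norm (snd (z s) u) * \<bar>fst (y s) v - fst (y s) u\<bar>
        \<le> C' * E * B\<^sup>2 * q ^ (n + k - 2) * h ^ 1"
      by (rule mult_order_bound[OF Zu(2) dY]) (use q nonneg E in simp_all)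
    moreover have "snd (cmult (y s) (z s)) v - snd (cmult (y s) (z s)) u
        = fst (z s) v *\<^sub>R (snd (y s) v - snd (y s) u) + (fst (z s) v - fst (z s) u) *\<^sub>R snd (y s) u
        + (fst (y s) v *\<^sub>R (snd (z s) v - snd (z s) u) + (fst (y s) v - fst (y s) u) *\<^sub>R snd (z s) u)"
      by (simp add: cmult_def algebra_simps)
    hence "norm (snd (cmult (y s) (z s)) v - snd (cmult (y s) (z s)) u)
        \<le> \<bar>fst (z s) v\<bar> * norm (snd (y s) v - snd (y s) u)
         + \<bar>fst (z s) v - fst (z s) u\<bar> * norm (snd (y s) u)
         + (\<bar>fst (y s) v\<bar> * norm (snd (z s) v - snd (z s) u)
         + \<bar>fst (y s) v - fst (y s) u\<bar> * norm (snd (z s) u))"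
      by (simp only: flip: norm_scaleR) (intro norm_triangle_mono order_refl)
    ultimately show "norm (snd (cmult (y s) (z s)) v - snd (cmult (y s) (z s)) u)
        \<le> ((2 * C * C' + C * E' + C' * E) * B\<^sup>2) * d s v ^ (n + k - 2) * d u v"
      unfolding q_def[symmetric] h_def[symmetric] by (simp add: algebra_simps)

    have "\<bar>fst (y s) v - fst (y s) u\<bar> * \<bar>fst (z s) v - fst (z s) u\<bar>
        \<le> E * E' * B\<^sup>2 * q ^ (n + k - 2) * h\<^sup>2"
      by (rule mult_order_bound[OF dY dZ]) (use q nonneg E in simp_all)
    moreover have "\<bar>?Ry\<bar> * \<bar>fst (z s) u\<bar> \<le> C * C' * B\<^sup>2 * q ^ (n + k - 2) * h\<^sup>2"
      by (rule mult_order_bound[OF RY Zu(1)]) (use q nonneg E in simp_all)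
    moreover have "\<bar>?Rz\<bar> * \<bar>fst (y s) u\<bar> \<le> C' * C * B\<^sup>2 * q ^ (n + k - 2) * h\<^sup>2"
      by (rule mult_order_bound[OF RZ Yu(1)]) (use q nonneg E in simp_all)
    moreover have "remainder X (fst (cmult (y s) (z s))) (snd (cmult (y s) (z s))) u v
        = (fst (y s) v - fst (y s) u) * (fst (z s) v - fst (z s) u) + ?Ry * fst (z s) u + ?Rz * fst (y s) u"
      by (simp add: cmult_def remainder_def blinfun.add_left blinfun.scaleR_left algebra_simps)
    hence "\<bar>remainder X (fst (cmult (y s) (z s))) (snd (cmult (y s) (z s))) u v\<bar>
        \<le> \<bar>fst (y s) v - fst (y s) u\<bar> * \<bar>fst (z s) v - fst (z s) u\<bar>
         + \<bar>?Ry\<bar> * \<bar>fst (z s) u\<bar> + \<bar>?Rz\<bar> * \<bar>fst (y s) u\<bar>"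
      by (simp only: flip: abs_mult)
    ultimately show "\<bar>remainder X (fst (cmult (y s) (z s))) (snd (cmult (y s) (z s))) u v\<bar>
        \<le> ((E * E' + 2 * C * C') * B\<^sup>2) * d s v ^ (n + k - 2) * (d u v)\<^sup>2"
      unfolding q_def[symmetric] h_def[symmetric] by (simp add: algebra_simps)
  qed
qed

section \<open>Rough integration raises the grade by one\<close>

text \<open>Chen's relation turns the area of the long interval into a product of increments of \<open>X\<close>, which
  cancels the leading part of the product of the increments of integrand and driver. Every surviving
  term is of third order.\<close>
lemma germ_defect_eq:
  assumes "0 \<le> u" "u \<le> r" "r \<le> v" "v \<le> T"
  shows "germ XX y w u v - germ XX y w u r - germ XX y w r v =
    - (remainder X (fst y) (snd y) u r * (fst w v - fst w r))
    - snd y u (X r - X u) * remainder X (fst w) (snd w) r v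
    - snd y u (X r - X u) * (snd w r - snd w u) (X v - X r)
    - area (snd y r - snd y u) (snd w r) (XX r v)
    - area (snd y u) (snd w r - snd w u) (XX r v)"
  unfolding germ_def chen[OF assms] area_add_matrix area_tensor area_diff_left area_diff_right
    remainder_def
  by (simp add: blinfun.diff_left algebra_simps)

text \<open>Each of the five terms has total order three in the increments, and the worst factor of \<open>y\<close> has
  weight \<open>d s V ^ (n - 2)\<close>. For \<open>n > 2\<close> the constant thus
  shrinks with \<open>V - s\<close>, as needed for a local use of sewing.\<close>
lemma germ_defect_le:
  assumes "graded n y" "graded 0 (\<lambda>_. w)"
  shows "\<exists>c\<ge>0. \<forall>s V. 0 \<le> s \<and> s \<le> V \<and> V \<le> T \<longrightarrow>
    defect_le (germ XX (y s) w) (3 * \<alpha>) (c * d s V ^ (n - 2)) s V"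
proof -
  obtain C C' where y: "graded_with C n y" and w: "graded_with C' 0 (\<lambda>_. w)"
    using assms unfolding graded_def by blast
  define E' where "E' = C' * (B\<^sup>2 + K)"
  define k where "k = (real CARD('d))\<^sup>2"
  have nonneg: "0 \<le> C" "0 \<le> C'" using y w by (auto simp: graded_with_def)
  hence E': "0 \<le> E'" and k: "0 \<le> k" using K by (auto simp: E'_def k_def)
  define c where "c = (C * E' + C * K * C' + (C * K) * (C' * K) + k * C * C' * K + k * C * C' * K) * B\<^sup>2"
  have c: "0 \<le> c" using nonneg E' k K by (simp add: c_def)
  show ?thesis
  proof (intro exI[of _ c] conjI allI impI c, elim conjE)
    fix s V assume sV: "0 \<le> s" "s \<le> V" "V \<le> T"
    define q where "q = d s V"
    show "defect_le (germ XX (y s) w) (3 * \<alpha>) (c * d s V ^ (n - 2)) s V"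
      unfolding defect_le_def
    proof (intro allI impI, elim conjE)
      fix u r v assume o: "s \<le> u" "u \<le> r" "r \<le> v" "v \<le> V"
      define h where "h = d u v"
      have o': "0 \<le> u" "0 \<le> r" "r \<le> T" "v \<le> T" using o sV by auto
      have q: "0 \<le> q" "q \<le> B" "0 \<le> h" using d_le_B[of s V] sV by (auto simp: q_def h_def)
      have mono: "d s u ^ i \<le> q ^ i" "d s r ^ i \<le> q ^ i" "d u r ^ i \<le> h ^ i" "d r v ^ i \<le> h ^ i" for i
        unfolding q_def h_def using o by (auto intro!: power_mono d_mono)
      note Y = graded_withD[OF y sV(1) o(1,2) o'(3)]
      note W = graded_withD[OF w o'(2) order_refl o(3) o'(4)]
        and W' = graded_withD[OF w o'(1) order_refl o(2) o'(3)]
      have Ry: "\<bar>remainder X (fst (y s)) (snd (y s)) u r\<bar> \<le> C * q ^ (n - 2) * h ^ 2"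
        using order_trans[OF Y(5) mult_mono[OF mult_left_mono[OF mono(2) Y(1)] mono(3)]] q Y(1) by simp
      have dy': "norm (snd (y s) r - snd (y s) u) \<le> C * q ^ (n - 2) * h ^ 1"
        using order_trans[OF Y(4) mult_mono[OF mult_left_mono[OF mono(2) Y(1)] mono(3)[of 1, unfolded power_one_right]]] q Y(1) by simp
      have y': "norm (snd (y s) u) \<le> C * q ^ (n - 1) * h ^ 0"
        using order_trans[OF Y(3) mult_left_mono[OF mono(1) Y(1)]] by simp
      have dw: "\<bar>fst w v - fst w r\<bar> \<le> E' * q ^ 0 * h ^ 1"
        using graded_with_increment[OF w o'(2) order_refl o(3) o'(4)] mult_left_mono[OF mono(4)[of 1] E']
        by (simp add: E'_def)
      have Rw: "\<bar>remainder X (fst w) (snd w) r v\<bar> \<le> C' * q ^ 0 * h ^ 2"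
        using order_trans[OF W(5), of "C' * h ^ 2"] mult_left_mono[OF mono(4)[of 2] nonneg(2)] by simp
      have dw': "norm (snd w r - snd w u) \<le> C' * h"
        using order_trans[OF W'(4), of "C' * h"] mult_left_mono[OF mono(3)[of 1] nonneg(2)] by simp
      have w': "norm (snd w r) \<le> C'" using W(3) by simp
      have Xu: "norm (X r - X u) \<le> K * h"
        using order_trans[OF X_bound[OF o'(1) o(2) o'(3)] mult_left_mono[OF mono(3)[of 1, simplified] K]] .
      have Xr: "norm (X v - X r) \<le> K * h"
        using order_trans[OF X_bound[OF o'(2) o(3) o'(4)] mult_left_mono[OF mono(4)[of 1, simplified] K]] .
      have XXr: "norm (XX r v) \<le> K * h ^ 2"
        using order_trans[OF XX_bound[OF o'(2) o(3) o'(4)] mult_left_mono[OF mono(4)[of 2] K]] .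
      have yX: "\<bar>snd (y s) u (X r - X u)\<bar> \<le> C * K * q ^ (n - 1) * h ^ 1"
        using norm_blinfun[of "snd (y s) u" "X r - X u"]
          mult_mono[OF y' Xu] nonneg q K by (simp add: mult_ac)
      have wX: "\<bar>(snd w r - snd w u) (X v - X r)\<bar> \<le> C' * K * q ^ 0 * h ^ 2"
        using norm_blinfun[of "snd w r - snd w u" "X v - X r"]
          mult_mono[OF dw' Xr] nonneg q K by (simp add: mult_ac power2_eq_square)
      have wXX: "norm (snd w r) * norm (XX r v) \<le> C' * K * q ^ 0 * h ^ 2"
        using mult_mono[OF w' XXr] nonneg q K by (simp add: mult_ac)
      have dwXX: "norm (snd w r - snd w u) * norm (XX r v) \<le> C' * K * q ^ 0 * h ^ 3"
        using mult_mono[OF dw' XXr] nonneg q K by (simp add: mult_ac power2_eq_square power3_eq_cube)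
      note bounds = mult_order_bound[where q = q and h = h and e = "n - 2" and m = 3]
      have 1: "\<bar>remainder X (fst (y s)) (snd (y s)) u r\<bar> * \<bar>fst w v - fst w r\<bar>
          \<le> C * E' * B\<^sup>2 * q ^ (n - 2) * h ^ 3"
        by (rule bounds[OF Ry dw]) (use q nonneg E' in simp_all)
      have 2: "\<bar>snd (y s) u (X r - X u)\<bar> * \<bar>remainder X (fst w) (snd w) r v\<bar>
          \<le> C * K * C' * B\<^sup>2 * q ^ (n - 2) * h ^ 3"
        by (rule bounds[OF yX Rw]) (use q nonneg K in simp_all)
      have 3: "\<bar>snd (y s) u (X r - X u)\<bar> * \<bar>(snd w r - snd w u) (X v - X r)\<bar>
          \<le> (C * K) * (C' * K) * B\<^sup>2 * q ^ (n - 2) * h ^ 3"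
        by (rule bounds[OF yX wX]) (use q nonneg K in simp_all)
      have "norm (snd (y s) r - snd (y s) u) * (norm (snd w r) * norm (XX r v))
          \<le> C * (C' * K) * B\<^sup>2 * q ^ (n - 2) * h ^ 3"
        by (rule bounds[OF dy' wXX]) (use q nonneg K in simp_all)
      hence 4: "\<bar>area (snd (y s) r - snd (y s) u) (snd w r) (XX r v)\<bar>
          \<le> k * (C * (C' * K) * B\<^sup>2 * q ^ (n - 2) * h ^ 3)"
        unfolding k_def by (intro order_trans[OF abs_area_le] mult_left_mono) (simp_all add: mult.assoc)
      have "norm (snd (y s) u) * (norm (snd w r - snd w u) * norm (XX r v))
          \<le> C * (C' * K) * B\<^sup>2 * q ^ (n - 2) * h ^ 3"
        by (rule bounds[OF y' dwXX]) (use q nonneg K in simp_all)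
      hence 5: "\<bar>area (snd (y s) u) (snd w r - snd w u) (XX r v)\<bar>
          \<le> k * (C * (C' * K) * B\<^sup>2 * q ^ (n - 2) * h ^ 3)"
        unfolding k_def by (intro order_trans[OF abs_area_le] mult_left_mono) (simp_all add: mult.assoc)
      have tri: "\<bar>- a - b - c - d - e\<bar> \<le> \<bar>a\<bar> + \<bar>b\<bar> + \<bar>c\<bar> + \<bar>d\<bar> + \<bar>e\<bar>" for a b c d e :: real
        by linarith
      have "\<bar>germ XX (y s) w u v - germ XX (y s) w u r - germ XX (y s) w r v\<bar>
          \<le> c * q ^ (n - 2) * h ^ 3"
        unfolding germ_defect_eq[OF o'(1) o(2,3) o'(4)]
        by (rule order_trans[OF tri], unfold abs_mult, rule order_trans[OF
          add_mono[OF add_mono[OF add_mono[OF add_mono[OF 1 2] 3] 4] 5]]) (simp add: c_def algebra_simps)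
      also have "h ^ 3 = (v - u) powr (3 * \<alpha>)"
        by (simp add: h_def hgap_def powr_powr mult.commute flip: powr_numeral)
      finally show "norm (germ XX (y s) w u v - germ XX (y s) w u r - germ XX (y s) w r v)
          \<le> c * d s V ^ (n - 2) * (v - u) powr (3 * \<alpha>)" by (simp add: q_def)
    qed
  qed
qed

text \<open>Sewing is applied on \<open>[s, T]\<close>, which identifies the integrals for all upper limits as values of
  one additive function; the increment over \<open>[u, v]\<close> is then estimated with the smaller constant
  that is valid on \<open>[s, v]\<close>.\<close>
lemma cintegral_increment:
  assumes "graded n y" "graded 0 (\<lambda>_. w)"
  shows "\<exists>M\<ge>0. \<forall>s u v. 0 \<le> s \<and> s \<le> u \<and> u \<le> v \<and> v \<le> T \<longrightarrow>
    fst (cintegral XX s (y s) w) s = 0 \<and>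
    \<bar>fst (cintegral XX s (y s) w) v - fst (cintegral XX s (y s) w) u - germ XX (y s) w u v\<bar>
      \<le> M * d s v ^ (n - 2) * d u v ^ 3"
proof -
  obtain c where c: "0 \<le> c" and defect: "\<And>s V. 0 \<le> s \<Longrightarrow> s \<le> V \<Longrightarrow> V \<le> T \<Longrightarrow>
       defect_le (germ XX (y s) w) (3 * \<alpha>) (c * d s V ^ (n - 2)) s V"
    using germ_defect_le[OF assms] by blast
  have \<theta>: "1 < 3 * \<alpha>" using alpha by simp
  define M where "M = sewing_const (3 * \<alpha>) * c"
  have "\<exists>I. (\<forall>u. s \<le> u \<and> u \<le> T \<longrightarrow> fst (cintegral XX s (y s) w) u = I s u) \<and> I s s = 0 \<and>
      (\<forall>u v. s \<le> u \<and> u \<le> v \<and> v \<le> T \<longrightarrow> I s v = I s u + I u v \<and>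
        \<bar>I u v - germ XX (y s) w u v\<bar> \<le> M * d s v ^ (n - 2) * d u v ^ 3)"
    if s: "0 \<le> s" "s \<le> T" for s
  proof -
    let ?c = "\<lambda>V. c * d s V ^ (n - 2)"
    have sew: "\<exists>I. (\<forall>u r v. s \<le> u \<and> u \<le> r \<and> r \<le> v \<and> v \<le> T \<longrightarrow> I u v = I u r + I r v) \<and>
      (\<forall>u v c'. s \<le> u \<and> u \<le> v \<and> v \<le> T \<and> 0 \<le> c' \<and> defect_le (germ XX (y s) w) (3 * \<alpha>) c' u v \<longrightarrow>
        norm (I u v - germ XX (y s) w u v) \<le> sewing_const (3 * \<alpha>) * c' * (v - u) powr (3 * \<alpha>))"
      by (rule sewing[OF \<theta> _ defect[OF s order_refl]]) (use c in simp)
    then obtain I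
      where add: "\<And>u r v. s \<le> u \<Longrightarrow> u \<le> r \<Longrightarrow> r \<le> v \<Longrightarrow> v \<le> T \<Longrightarrow> I u v = I u r + I r v"
      and near: "\<And>u v c'. s \<le> u \<Longrightarrow> u \<le> v \<Longrightarrow> v \<le> T \<Longrightarrow> 0 \<le> c' \<Longrightarrow>
        defect_le (germ XX (y s) w) (3 * \<alpha>) c' u v \<Longrightarrow>
        norm (I u v - germ XX (y s) w u v) \<le> sewing_const (3 * \<alpha>) * c' * (v - u) powr (3 * \<alpha>)"
      by blast
    have near': "\<bar>I u v - germ XX (y s) w u v\<bar> \<le> sewing_const (3 * \<alpha>) * ?c V * (v - u) powr (3 * \<alpha>)"
      if o: "s \<le> u" "u \<le> v" "v \<le> V" "V \<le> T" for u v V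
      using near[OF o(1,2) order_trans[OF o(3,4)] _ defect_le_subinterval[OF defect[OF s(1) _ o(4)] o(1,3)]]
        c o by simp
    have "fst (cintegral XX s (y s) w) t = I s t" if t: "s \<le> t" "t \<le> T" for t
      unfolding cintegral_germ
    proof (rule tendsto_Lim[OF fine_divisions_neq_bot[OF t(1)] additive_limit_of_division_sums[OF \<theta> t(1)]])
      show "I s v = I s u + I u v" if "s \<le> u" "u \<le> v" "v \<le> t" for u v
        using that t by (intro add) auto
      show "norm (I u v - germ XX (y s) w u v) \<le> sewing_const (3 * \<alpha>) * ?c T * (v - u) powr (3 * \<alpha>)"
        if "s \<le> u" "u \<le> v" "v \<le> t" for u v
        using near'[of u v T] that t by simp
    qed
    moreover have "I s s = 0" using add[of s s s] s by simp
    moreover have "I s v = I s u + I u v" if "s \<le> u" "u \<le> v" "v \<le> T" for u v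
      using that by (intro add) auto
    moreover have "\<bar>I u v - germ XX (y s) w u v\<bar> \<le> M * d s v ^ (n - 2) * d u v ^ 3"
      if "s \<le> u" "u \<le> v" "v \<le> T" for u v
    proof -
      have "(v - u) powr (3 * \<alpha>) = d u v ^ 3"
        by (simp add: hgap_def powr_powr mult.commute flip: powr_numeral)
      thus ?thesis using near'[OF that(1,2) order_refl that(3)] by (simp add: M_def mult.assoc)
    qed
    ultimately show ?thesis by (intro exI[of _ I]) blast
  qed
  note I = this
  have "0 \<le> M" using c sewing_const_nonneg[OF \<theta>] by (simp add: M_def)
  moreover have "fst (cintegral XX s (y s) w) s = 0 \<and>
      \<bar>fst (cintegral XX s (y s) w) v - fst (cintegral XX s (y s) w) u - germ XX (y s) w u v\<bar>
       \<le> M * d s v ^ (n - 2) * d u v ^ 3" if o: "0 \<le> s" "s \<le> u" "u \<le> v" "v \<le> T" for s u v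
  proof -
    have sT: "s \<le> T" "s \<le> v" "u \<le> T" using o by auto
    obtain I where "\<forall>u. s \<le> u \<and> u \<le> T \<longrightarrow> fst (cintegral XX s (y s) w) u = I s u" "I s s = 0"
      "I s v = I s u + I u v" "\<bar>I u v - germ XX (y s) w u v\<bar> \<le> M * d s v ^ (n - 2) * d u v ^ 3"
      using I[OF o(1) sT(1)] o by blast
    thus ?thesis using o sT by simp
  qed
  ultimately show ?thesis by blast
qed

lemma snd_cintegral: "snd (cintegral XX s y w) r = fst y r *\<^sub>R snd w r"
  by (simp add: cintegral_def)

text \<open>Writing the integral as germ plus sewing error, the sewing error carries
  \<open>d s v ^ (n - 2) * d u v ^ 3\<close>, where a factor \<open>d u v\<close> is spent to raise \<open>n - 2\<close> to \<open>n - 1\<close>. From the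
  base point itself, \<open>u = s\<close>, everything becomes a power of \<open>d s v\<close>, and the germ has order
  \<open>n + 1\<close> because the integrand and its derivative already vanish to orders \<open>n\<close> and \<open>n - 1\<close>.\<close>
lemma graded_cintegral:
  assumes "graded n y" "graded 0 (\<lambda>_. w)"
  shows "graded (Suc n) (\<lambda>s. cintegral XX s (y s) w)"
proof -
  obtain C C' where y: "graded_with C n y" and w: "graded_with C' 0 (\<lambda>_. w)"
    using assms unfolding graded_def by blast
  obtain M where M: "0 \<le> M" and inc: "\<And>s u v. 0 \<le> s \<Longrightarrow> s \<le> u \<Longrightarrow> u \<le> v \<Longrightarrow> v \<le> T \<Longrightarrow>
    fst (cintegral XX s (y s) w) s = 0 \<and>
    \<bar>fst (cintegral XX s (y s) w) v - fst (cintegral XX s (y s) w) u - germ XX (y s) w u v\<bar>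
      \<le> M * d s v ^ (n - 2) * d u v ^ 3"
    using cintegral_increment[OF assms] by blast
  define E where "E = C * (B\<^sup>2 + K)"
  define E' where "E' = C' * (B\<^sup>2 + K)"
  define k where "k = (real CARD('d))\<^sup>2"
  have nonneg: "0 \<le> C" "0 \<le> C'" using y w by (auto simp: graded_with_def)
  hence E: "0 \<le> E" "0 \<le> E'" and k: "0 \<le> k" using K by (auto simp: E_def E'_def k_def)
  \<comment> \<open>The area has order two in \<open>d u v\<close>; \<open>b\<close> of these orders are charged to \<open>d s v\<close>.\<close>
  have area_bound: "\<bar>area (snd (y s) u) (snd w u) (XX u v)\<bar>
      \<le> k * (C * (C' * K) * B\<^sup>2 * d s v ^ e * d u v ^ m)"
    if o: "0 \<le> s" "s \<le> u" "u \<le> v" "v \<le> T" and e: "d u v ^ 2 = d s v ^ b * d u v ^ m"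
      "e \<le> n - 1 + b" "n - 1 + b \<le> e + 2" for s u v e b m
  proof -
    have uT: "u \<le> T" "0 \<le> u" using o by auto
    have "norm (snd (y s) u) \<le> C * d s v ^ (n - 1) * d u v ^ 0"
      using graded_withD(3)[OF y o] mult_left_mono[OF power_mono[OF d_mono[OF order_refl o(2,3)], of "n - 1"] nonneg(1)]
      by simp
    moreover have "norm (snd w u) * norm (XX u v) \<le> C' * (K * d u v ^ 2)"
      using graded_withD(3)[OF w o] XX_bound[OF uT(2) o(3,4)] nonneg by (intro mult_mono) auto
    hence "norm (snd w u) * norm (XX u v) \<le> C' * K * d s v ^ b * d u v ^ m"
      using e(1) by (simp add: mult.assoc)
    ultimately have "norm (snd (y s) u) * (norm (snd w u) * norm (XX u v))
        \<le> C * (C' * K) * B\<^sup>2 * d s v ^ e * d u v ^ m"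
      by (rule mult_order_bound) (use nonneg K d_le_B[of s v] o e(2,3) in simp_all)
    thus ?thesis
      unfolding k_def by (intro order_trans[OF abs_area_le] mult_left_mono) (simp_all add: mult.assoc)
  qed
  show ?thesis
  proof (rule gradedI)
    fix s u :: real assume o: "0 \<le> s" "s \<le> u" "u \<le> T"
    note Y = graded_withD[OF y o(1) order_refl o(2,3)]
    define q where "q = d s u"
    have q: "0 \<le> q" "q \<le> B" using d_le_B o by (auto simp: q_def)
    have ys: "\<bar>fst (y s) s\<bar> \<le> C * q ^ n * 0 ^ 0"
      using Y(2) mult_left_mono[OF power_mono[of 0 q n] nonneg(1)] q by simp
    have dw: "\<bar>fst w u - fst w s\<bar> \<le> E' * q ^ 1 * 0 ^ 0"
      using graded_with_increment[OF w o(1) order_refl o(2,3)] by (simp add: E'_def q_def)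
    have 1: "\<bar>fst (y s) s\<bar> * \<bar>fst w u - fst w s\<bar> \<le> C * E' * B\<^sup>2 * q ^ Suc n * 0 ^ 0"
      by (rule mult_order_bound[OF ys dw]) (use nonneg E q in simp_all)
    have 2: "\<bar>area (snd (y s) s) (snd w s) (XX s u)\<bar> \<le> k * (C * (C' * K) * B\<^sup>2 * q ^ Suc n * q ^ 0)"
      unfolding q_def by (rule area_bound[where b = 2]) (use o in auto)
    have "(M * q ^ (n - 2)) * q ^ 3 \<le> M * 1 * B\<^sup>2 * q ^ Suc n * 0 ^ 0"
      by (rule mult_order_bound[where a = "n - 2" and b = 3 and i = 0 and j = 0]) (use q M in simp_all)
    hence 3: "\<bar>fst (cintegral XX s (y s) w) u - germ XX (y s) w s u\<bar> \<le> M * B\<^sup>2 * q ^ Suc n"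
      using inc[OF o(1) order_refl o(2,3)] unfolding q_def by (elim conjE) simp
    have "\<bar>germ XX (y s) w s u\<bar> \<le> \<bar>fst (y s) s\<bar> * \<bar>fst w u - fst w s\<bar>
        + \<bar>area (snd (y s) s) (snd w s) (XX s u)\<bar>"
      unfolding germ_def abs_mult[symmetric] by (rule abs_triangle_ineq)
    hence "\<bar>fst (cintegral XX s (y s) w) u\<bar> \<le> C * E' * B\<^sup>2 * q ^ Suc n
        + k * (C * (C' * K) * B\<^sup>2 * q ^ Suc n) + M * B\<^sup>2 * q ^ Suc n"
      using 1 2 3 unfolding power_0 mult_1_right by linarith
    also have "\<dots> = ((C * E' + k * (C * (C' * K)) + M) * B\<^sup>2) * q ^ Suc n"
      by (simp only: ring_distribs mult.assoc)
    finally show "\<bar>fst (cintegral XX s (y s) w) u\<bar>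
        \<le> ((C * E' + k * (C * (C' * K)) + M) * B\<^sup>2) * d s u ^ Suc n" by (simp only: q_def)

    have "\<bar>fst (y s) u\<bar> * norm (snd w u) \<le> (C * d s u ^ n) * C'"
      using graded_withD(2)[OF y o(1,2) order_refl o(3)] graded_withD(3)[OF w o(1,2) order_refl o(3)]
        nonneg by (intro mult_mono) auto
    thus "norm (snd (cintegral XX s (y s) w) u) \<le> (C * C') * d s u ^ (Suc n - 1)"
      by (simp add: snd_cintegral mult_ac)
  next
    fix s u v :: real assume o: "0 \<le> s" "s \<le> u" "u \<le> v" "v \<le> T"
    have sv: "s \<le> v" using o by auto
    note Y = graded_withD[OF y o] and W = graded_withD[OF w o]
    define q where "q = d s v"
    define h where "h = d u v"
    have q: "0 \<le> q" "q \<le> B" "0 \<le> h" "h \<le> q" "d s u ^ i \<le> q ^ i" for i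
      using d_le_B[of s v] o by (auto simp: q_def h_def intro!: power_mono d_mono)
    have Yu: "\<bar>fst (y s) u\<bar> \<le> C * q ^ n * h ^ 0"
      using order_trans[OF Y(2) mult_left_mono[OF q(5) nonneg(1)]] by simp
    have dY: "\<bar>fst (y s) v - fst (y s) u\<bar> \<le> E * q ^ (n - 1) * h ^ 1"
      using graded_with_increment[OF y o] by (simp add: E_def q_def h_def)
    have w': "norm (snd w v) \<le> C' * q ^ 0 * h ^ 0"
      using graded_withD(3)[OF w o(1) sv order_refl o(4)] by simp
    have dw': "norm (snd w v - snd w u) \<le> C' * q ^ 0 * h ^ 1"
      using W(4) by (simp add: h_def)
    have Rw: "\<bar>remainder X (fst w) (snd w) u v\<bar> \<le> C' * q ^ 0 * h ^ 2"
      using W(5) by (simp add: h_def)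
    have 1: "\<bar>fst (y s) v - fst (y s) u\<bar> * norm (snd w v) \<le> E * C' * B\<^sup>2 * q ^ (Suc n - 2) * h ^ 1"
      by (rule mult_order_bound[OF dY w']) (use nonneg E q in simp_all)
    have 2: "\<bar>fst (y s) u\<bar> * norm (snd w v - snd w u) \<le> C * C' * B\<^sup>2 * q ^ (Suc n - 2) * h ^ 1"
      by (rule mult_order_bound[OF Yu dw']) (use nonneg q in simp_all)
    have "snd (cintegral XX s (y s) w) v - snd (cintegral XX s (y s) w) u
        = (fst (y s) v - fst (y s) u) *\<^sub>R snd w v + fst (y s) u *\<^sub>R (snd w v - snd w u)"
      by (simp add: snd_cintegral algebra_simps)
    hence "norm (snd (cintegral XX s (y s) w) v - snd (cintegral XX s (y s) w) u)
        \<le> \<bar>fst (y s) v - fst (y s) u\<bar> * norm (snd w v) + \<bar>fst (y s) u\<bar> * norm (snd w v - snd w u)"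
      by (simp only: flip: norm_scaleR) (intro norm_triangle_ineq)
    also have "\<dots> \<le> E * C' * B\<^sup>2 * q ^ (Suc n - 2) * h ^ 1 + C * C' * B\<^sup>2 * q ^ (Suc n - 2) * h ^ 1"
      by (rule add_mono[OF 1 2])
    also have "\<dots> = ((E * C' + C * C') * B\<^sup>2) * q ^ (Suc n - 2) * h"
      by (simp only: ring_distribs mult.assoc power_one_right)
    finally show "norm (snd (cintegral XX s (y s) w) v - snd (cintegral XX s (y s) w) u)
        \<le> ((E * C' + C * C') * B\<^sup>2) * d s v ^ (Suc n - 2) * d u v" by (simp only: q_def h_def)

    \<comment> \<open>The last factor \<open>h \<le> q\<close> raises the exponent of \<open>q\<close>.\<close>
    have "(M * q ^ (n - 2) * h ^ 2) * h \<le> M * 1 * B\<^sup>2 * q ^ (Suc n - 2) * h ^ 2"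
      by (rule mult_order_bound[where a = "n - 2" and b = 1 and i = 2 and j = 0]) (use q M in simp_all)
    hence 3: "\<bar>fst (cintegral XX s (y s) w) v - fst (cintegral XX s (y s) w) u - germ XX (y s) w u v\<bar>
        \<le> M * B\<^sup>2 * q ^ (Suc n - 2) * h ^ 2"
      using inc[OF o] by (simp add: q_def h_def power2_eq_square power3_eq_cube mult.assoc)
    have 4: "\<bar>fst (y s) u\<bar> * \<bar>remainder X (fst w) (snd w) u v\<bar> \<le> C * C' * B\<^sup>2 * q ^ (Suc n - 2) * h ^ 2"
      by (rule mult_order_bound[OF Yu Rw]) (use nonneg q in simp_all)
    have 5: "\<bar>area (snd (y s) u) (snd w u) (XX u v)\<bar> \<le> k * (C * (C' * K) * B\<^sup>2 * q ^ (Suc n - 2) * h ^ 2)"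
      unfolding q_def h_def by (rule area_bound[where b = 0, OF o]) auto
    have "remainder X (fst (cintegral XX s (y s) w)) (snd (cintegral XX s (y s) w)) u v
        = (fst (cintegral XX s (y s) w) v - fst (cintegral XX s (y s) w) u - germ XX (y s) w u v)
          + fst (y s) u * remainder X (fst w) (snd w) u v + area (snd (y s) u) (snd w u) (XX u v)"
      by (simp add: remainder_def snd_cintegral germ_def blinfun.scaleR_left algebra_simps)
    hence "\<bar>remainder X (fst (cintegral XX s (y s) w)) (snd (cintegral XX s (y s) w)) u v\<bar>
        \<le> \<bar>fst (cintegral XX s (y s) w) v - fst (cintegral XX s (y s) w) u - germ XX (y s) w u v\<bar>
          + \<bar>fst (y s) u\<bar> * \<bar>remainder X (fst w) (snd w) u v\<bar> + \<bar>area (snd (y s) u) (snd w u) (XX u v)\<bar>"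
      unfolding abs_mult[symmetric] by linarith
    also have "\<dots> \<le> M * B\<^sup>2 * q ^ (Suc n - 2) * h ^ 2 + C * C' * B\<^sup>2 * q ^ (Suc n - 2) * h ^ 2
        + k * (C * (C' * K) * B\<^sup>2 * q ^ (Suc n - 2) * h ^ 2)"
      by (intro add_mono 3 4 5)
    also have "\<dots> = ((M + C * C' + k * (C * (C' * K))) * B\<^sup>2) * q ^ (Suc n - 2) * h\<^sup>2"
      by (simp only: ring_distribs mult.assoc)
    finally show "\<bar>remainder X (fst (cintegral XX s (y s) w)) (snd (cintegral XX s (y s) w)) u v\<bar>
        \<le> ((M + C * C' + k * (C * (C' * K))) * B\<^sup>2) * d s v ^ (Suc n - 2) * (d u v)\<^sup>2"
      by (simp only: q_def h_def)
  qed
qed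

end

section \<open>Coefficients of trees and forests\<close>

lemma sum_mset_scaleR: "(\<Sum>x\<in>#M. c *\<^sub>R f x) = c *\<^sub>R (\<Sum>x\<in>#M. f x)"
  for f :: "'a \<Rightarrow> 'b::real_vector"
  by (induction M) (simp_all add: scaleR_add_right)

lemma cprod_empty: "cprod {#} = (\<lambda>_. 1, \<lambda>_. 0)"
  by (simp add: cprod_def)

lemma cprod_add_mset: "cprod (add_mset y M) = cmult y (cprod M)"
proof -
  have "(\<Sum>x\<in>#M. (\<Prod>w\<in>#add_mset y M - {#x#}. fst w r) *\<^sub>R snd x r)
      = fst y r *\<^sub>R (\<Sum>x\<in>#M. (\<Prod>w\<in>#M - {#x#}. fst w r) *\<^sub>R snd x r)" for r
  proof -
    have "add_mset y M - {#x#} = add_mset y (M - {#x#})" if "x \<in># M" for x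
      using diff_union_single_conv[OF that, of "{#y#}"] by simp
    hence "(\<Sum>x\<in>#M. (\<Prod>w\<in>#add_mset y M - {#x#}. fst w r) *\<^sub>R snd x r)
        = (\<Sum>x\<in>#M. fst y r *\<^sub>R ((\<Prod>w\<in>#M - {#x#}. fst w r) *\<^sub>R snd x r))"
      by (intro arg_cong[of _ _ sum_mset] image_mset_cong) simp
    thus ?thesis by (simp only: sum_mset_scaleR)
  qed
  thus ?thesis by (simp add: cprod_def cmult_def)
qed

lemma tree_vertices_Node: "tree_vertices (Node a \<eta>) = Suc (vertices \<eta>)"
  by (simp add: vertices_def)

lemma tree_coeff_Node:
  "tree_coeff XX Z Z' s (Node a \<eta>) = cintegral XX s (forest_coeff_pair XX Z Z' s \<eta>) (component Z Z' a)"
  by (simp add: forest_coeff_pair_def)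

lemma tree_vertices_pos: "1 \<le> tree_vertices \<tau>"
  by (cases \<tau>) simp

lemma size_le_vertices: "size \<eta> \<le> vertices \<eta>"
  unfolding vertices_def
proof (induction \<eta>)
  case (add \<tau> \<eta>)
  thus ?case using tree_vertices_pos[of \<tau>] by simp
qed simp

lemma tree_vertices_le_vertices:
  assumes "\<tau> \<in># \<eta>"
  shows "tree_vertices \<tau> \<le> vertices \<eta>"
proof -
  obtain \<eta>' where "\<eta> = add_mset \<tau> \<eta>'" using assms by (rule mset_add)
  thus ?thesis by (simp add: vertices_def)
qed

text \<open>Forests with at most \<open>Suc p\<close> vertices are multisets of bounded size over the trees with at most
  \<open>Suc p\<close> vertices, and these trees are roots joined to forests with at most \<open>p\<close> vertices.\<close>
lemma finite_forests_vertices_le: "finite {\<eta> :: 'm::finite forest. vertices \<eta> \<le> p}"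
proof (induction p)
  case 0
  have "{\<eta> :: 'm forest. vertices \<eta> \<le> 0} \<subseteq> {{#}}"
  proof
    fix \<eta> :: "'m forest" assume "\<eta> \<in> {\<eta>. vertices \<eta> \<le> 0}"
    thus "\<eta> \<in> {{#}}" using size_le_vertices[of \<eta>] by simp
  qed
  thus ?case by (rule finite_subset) simp
next
  case (Suc p)
  define A :: "'m rtree set" where "A = (\<lambda>(a, \<eta>). Node a \<eta>) ` (UNIV \<times> {\<eta>. vertices \<eta> \<le> p})"
  have A: "\<tau> \<in> A" if "tree_vertices \<tau> \<le> Suc p" for \<tau>
    using that unfolding A_def by (cases \<tau>) (auto simp: vertices_def image_iff)
  have "{\<eta> :: 'm forest. vertices \<eta> \<le> Suc p} \<subseteq> (\<Union>n\<in>{..Suc p}. multisets_of_size A n)"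
  proof
    fix \<eta> :: "'m forest" assume "\<eta> \<in> {\<eta>. vertices \<eta> \<le> Suc p}"
    hence "vertices \<eta> \<le> Suc p" by simp
    moreover from this have "set_mset \<eta> \<subseteq> A" by (meson A tree_vertices_le_vertices order_trans subsetI)
    ultimately show "\<eta> \<in> (\<Union>n\<in>{..Suc p}. multisets_of_size A n)"
      using size_le_vertices[of \<eta>] by (simp add: multisets_of_size_def)
  qed
  moreover have "finite A" using Suc.IH unfolding A_def by simp
  hence "finite (\<Union>n\<in>{..Suc p}. multisets_of_size A n)"
    by (intro finite_UN_I finite_atMost finite_multisets_of_size)
  ultimately show ?case by (rule finite_subset)
qed

lemma finite_forests_upto: "finite (forests_upto p :: 'm::finite forest set)"
  using finite_forests_vertices_le[of p] by (rule rev_finite_subset) (auto simp: forests_upto_def)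

section \<open>From graded families to seminorms\<close>

lemma holder2_seminorm_le:
  assumes "\<And>u v. a \<le> u \<Longrightarrow> u < v \<Longrightarrow> v \<le> b \<Longrightarrow> norm (R u v) \<le> c * (v - u) powr \<beta>"
  shows "holder2_seminorm \<beta> a b R \<le> ennreal c"
  unfolding holder2_seminorm_def
proof (rule SUP_least, clarify)
  fix u v assume "a \<le> u" "u < v" "v \<le> b"
  thus "ennreal (norm (R u v) / \<bar>v - u\<bar> powr \<beta>) \<le> ennreal c"
    using assms[of u v] by (intro ennreal_leI) (simp add: divide_le_eq)
qed

lemma holder2_seminorm_finiteD:
  assumes "holder2_seminorm \<beta> a b R < \<infinity>"
  shows "\<exists>c\<ge>0. \<forall>u v. a \<le> u \<and> u < v \<and> v \<le> b \<longrightarrow> norm (R u v) \<le> c * (v - u) powr \<beta>"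
proof (intro exI conjI allI impI)
  let ?c = "enn2real (holder2_seminorm \<beta> a b R)"
  show "0 \<le> ?c" by simp
  fix u v assume o: "a \<le> u \<and> u < v \<and> v \<le> b"
  have "ennreal (norm (R u v) / \<bar>v - u\<bar> powr \<beta>) \<le> holder2_seminorm \<beta> a b R"
    unfolding holder2_seminorm_def by (rule SUP_upper2[of "(u, v)"]) (use o in auto)
  also have "\<dots> = ennreal ?c" using assms by simp
  finally have "norm (R u v) / \<bar>v - u\<bar> powr \<beta> \<le> ?c" by simp
  thus "norm (R u v) \<le> ?c * (v - u) powr \<beta>" using o by (simp add: divide_le_eq)
qed

lemma hgap_power: "0 < n \<Longrightarrow> hgap \<alpha> u v ^ n = (v - u) powr (real n * \<alpha>)"
  by (cases "u = v") (simp_all add: hgap_def powr_power)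

lemmas hgap_power2 = hgap_power[of 2, simplified]

lemma rpow_eq_hgap_power:
  assumes "0 < \<alpha>" "u \<le> v"
  shows "rpow \<bar>v - u\<bar> (real n * \<alpha>) = hgap \<alpha> u v ^ n"
  using assms hgap_power[of n \<alpha> u v] by (cases "n = 0") (simp_all add: rpow_def)

context rough_setting begin

lemma graded_forest:
  assumes "\<And>\<tau>. \<tau> \<in># \<eta> \<Longrightarrow> graded (tree_vertices \<tau>) (\<lambda>s. tree_coeff XX Z Z' s \<tau>)"
  shows "graded (vertices \<eta>) (\<lambda>s. forest_coeff_pair XX Z Z' s \<eta>)"
  using assms
proof (induction \<eta>)
  case empty
  show ?case
    by (rule gradedI[where ?C1.0 = 1 and ?C2.0 = 0 and ?C3.0 = 0 and ?C4.0 = 0])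
      (simp_all add: forest_coeff_pair_def cprod_empty vertices_def remainder_def)
next
  case (add \<tau> \<eta>)
  have "graded (tree_vertices \<tau> + vertices \<eta>)
      (\<lambda>s. cmult (tree_coeff XX Z Z' s \<tau>) (forest_coeff_pair XX Z Z' s \<eta>))"
    using add.prems add.IH by (intro graded_cmult) auto
  thus ?case by (simp add: forest_coeff_pair_def cprod_add_mset vertices_def)
qed

lemma graded_tree:
  assumes "\<And>a. graded 0 (\<lambda>_. component Z Z' a)"
  shows "graded (tree_vertices \<tau>) (\<lambda>s. tree_coeff XX Z Z' s \<tau>)"
proof (induction \<tau>)
  case (Node a \<eta>)
  have "graded (vertices \<eta>) (\<lambda>s. forest_coeff_pair XX Z Z' s \<eta>)"
    using Node by (rule graded_forest)
  thus ?case
    unfolding tree_vertices_Node tree_coeff_Node by (intro graded_cintegral assms)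
qed

lemma graded_component:
  fixes Z :: "real \<Rightarrow> real ^ 'm" and Z' :: "real \<Rightarrow> (real ^ 'd) \<Rightarrow>\<^sub>L (real ^ 'm)"
  assumes "controlled \<alpha> 0 T X Z Z'"
  shows "graded 0 (\<lambda>_. component Z Z' a)"
proof -
  have "holder2_seminorm \<alpha> 0 T (\<lambda>u v. Z v - Z u) < \<infinity>"
    and "holder2_seminorm \<alpha> 0 T (\<lambda>u v. Z' v - Z' u) < \<infinity>"
    and "holder2_seminorm (2 * \<alpha>) 0 T (remainder X Z Z') < \<infinity>"
    using assms by (simp_all add: controlled_def holder_seminorm_def)
  note bounds = this[THEN holder2_seminorm_finiteD]
  obtain c1 where c1: "0 \<le> c1"
    "\<forall>u v. 0 \<le> u \<and> u < v \<and> v \<le> T \<longrightarrow> norm (Z v - Z u) \<le> c1 * (v - u) powr \<alpha>"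
    using bounds(1) by blast
  obtain c2 where c2: "0 \<le> c2"
    "\<forall>u v. 0 \<le> u \<and> u < v \<and> v \<le> T \<longrightarrow> norm (Z' v - Z' u) \<le> c2 * (v - u) powr \<alpha>"
    using bounds(2) by blast
  obtain c3 where c3: "0 \<le> c3"
    "\<forall>u v. 0 \<le> u \<and> u < v \<and> v \<le> T \<longrightarrow> norm (remainder X Z Z' u v) \<le> c3 * (v - u) powr (2 * \<alpha>)"
    using bounds(3) by blast
  have Z: "norm (Z v - Z u) \<le> c1 * d u v" "norm (Z' v - Z' u) \<le> c2 * d u v"
    "norm (remainder X Z Z' u v) \<le> c3 * (d u v)\<^sup>2" if o: "0 \<le> u" "u \<le> v" "v \<le> T" for u v
  proof -
    consider "u = v" | "u < v" using o by linarith
    thus "norm (Z v - Z u) \<le> c1 * d u v" "norm (Z' v - Z' u) \<le> c2 * d u v"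
      "norm (remainder X Z Z' u v) \<le> c3 * (d u v)\<^sup>2"
      using c1(2)[rule_format, of u v] c2(2)[rule_format, of u v] c3(2)[rule_format, of u v] o
      unfolding hgap_power2 by (cases; simp add: hgap_def remainder_def)+
  qed
  have apply_snd: "blinfun_apply (snd (component Z Z' a) u) x = blinfun_apply (Z' u) x $ a" for u x
    unfolding component_def snd_conv
    by (subst bounded_linear_Blinfun_apply)
      (intro bounded_linear_compose[OF bounded_linear_vec_nth] blinfun.bounded_linear_right, simp)
  have comp: "norm (snd (component Z Z' a) u) \<le> norm (Z' u)" for u
  proof (rule norm_blinfun_bound[OF norm_ge_zero])
    show "norm (blinfun_apply (snd (component Z Z' a) u) x) \<le> norm (Z' u) * norm x" for x
      using component_le_norm_cart[of "Z' u x" a] norm_blinfun[of "Z' u" x] by (simp add: apply_snd)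
  qed
  have dcomp: "norm (snd (component Z Z' a) v - snd (component Z Z' a) u) \<le> norm (Z' v - Z' u)" for u v
  proof (rule norm_blinfun_bound[OF norm_ge_zero])
    show "norm (blinfun_apply (snd (component Z Z' a) v - snd (component Z Z' a) u) x)
        \<le> norm (Z' v - Z' u) * norm x" for x
      using component_le_norm_cart[of "(Z' v - Z' u) x" a] norm_blinfun[of "Z' v - Z' u" x]
      by (simp add: apply_snd blinfun.diff_left)
  qed
  have rem: "remainder X (fst (component Z Z' a)) (snd (component Z Z' a)) u v = remainder X Z Z' u v $ a" for u v
    unfolding remainder_def apply_snd by (simp add: component_def)
  show ?thesis
  proof (rule gradedI)
    fix s u :: real assume o: "0 \<le> s" "s \<le> u" "u \<le> T"
    have u: "0 \<le> u" using o by simp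
    have du: "d 0 u \<le> B" using o by (intro d_le_B) auto
    have "norm (Z u) \<le> norm (Z 0) + c1 * B"
      using Z(1)[OF order_refl u o(3)] norm_triangle_sub[of "Z u" "Z 0"] mult_left_mono[OF du c1(1)] by linarith
    thus "\<bar>fst (component Z Z' a) u\<bar> \<le> (norm (Z 0) + c1 * B) * d s u ^ 0"
      using component_le_norm_cart[of "Z u" a] by (simp add: component_def)
    have "norm (Z' u) \<le> norm (Z' 0) + c2 * B"
      using Z(2)[OF order_refl u o(3)] norm_triangle_sub[of "Z' u" "Z' 0"] mult_left_mono[OF du c2(1)] by linarith
    thus "norm (snd (component Z Z' a) u) \<le> (norm (Z' 0) + c2 * B) * d s u ^ (0 - 1)"
      using comp[of u] by simp
  next
    fix s u v :: real assume o: "0 \<le> s" "s \<le> u" "u \<le> v" "v \<le> T"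
    have u: "0 \<le> u" using o by simp
    show "norm (snd (component Z Z' a) v - snd (component Z Z' a) u) \<le> c2 * d s v ^ (0 - 2) * d u v"
      using dcomp[of v u] Z(2)[OF u o(3,4)] by simp
    show "\<bar>remainder X (fst (component Z Z' a)) (snd (component Z Z' a)) u v\<bar>
        \<le> c3 * d s v ^ (0 - 2) * (d u v)\<^sup>2"
      using component_le_norm_cart[of "remainder X Z Z' u v" a] Z(3)[OF u o(3,4)] by (simp add: rem)
  qed
qed

lemma graded_with_seminorms:
  assumes y: "graded_with C n y" and st: "0 \<le> s" "s \<le> t" "t \<le> T"
  shows "holder_seminorm \<alpha> s t (fst (y s)) \<le> ennreal (C * (B\<^sup>2 + K) * d s t ^ (n - 1))"
    and "holder_seminorm \<alpha> s t (snd (y s)) \<le> ennreal (C * d s t ^ (n - 2))"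
    and "holder2_seminorm (2 * \<alpha>) s t (remainder X (fst (y s)) (snd (y s))) \<le> ennreal (C * d s t ^ (n - 2))"
proof -
  have C: "0 \<le> C" using y by (simp add: graded_with_def)
  have bd: "\<bar>fst (y s) v - fst (y s) u\<bar> \<le> C * (B\<^sup>2 + K) * d s t ^ (n - 1) * d u v"
    "norm (snd (y s) v - snd (y s) u) \<le> C * d s t ^ (n - 2) * d u v"
    "\<bar>remainder X (fst (y s)) (snd (y s)) u v\<bar> \<le> C * d s t ^ (n - 2) * (d u v)\<^sup>2"
    if o: "s \<le> u" "u < v" "v \<le> t" for u v
  proof -
    have o': "s \<le> v" "u \<le> v" "v \<le> T" using o st by auto
    have mono: "d s v ^ i \<le> d s t ^ i" for i using o by (intro power_mono d_mono) auto
    have weaken: "c * d s v ^ i * x \<le> c * d s t ^ i * x" if "0 \<le> c" "0 \<le> x" for c x i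
      using mono that by (intro mult_right_mono mult_left_mono)
    show "\<bar>fst (y s) v - fst (y s) u\<bar> \<le> C * (B\<^sup>2 + K) * d s t ^ (n - 1) * d u v"
      using C K by (intro order_trans[OF graded_with_increment[OF y st(1) o(1) o'(2,3)] weaken]) auto
    show "norm (snd (y s) v - snd (y s) u) \<le> C * d s t ^ (n - 2) * d u v"
      using C by (intro order_trans[OF graded_withD(4)[OF y st(1) o(1) o'(2,3)] weaken]) auto
    show "\<bar>remainder X (fst (y s)) (snd (y s)) u v\<bar> \<le> C * d s t ^ (n - 2) * (d u v)\<^sup>2"
      using C by (intro order_trans[OF graded_withD(5)[OF y st(1) o(1) o'(2,3)] weaken]) auto
  qed
  show "holder_seminorm \<alpha> s t (fst (y s)) \<le> ennreal (C * (B\<^sup>2 + K) * d s t ^ (n - 1))"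
    "holder_seminorm \<alpha> s t (snd (y s)) \<le> ennreal (C * d s t ^ (n - 2))"
    unfolding holder_seminorm_def using bd(1,2)
    by (auto intro!: holder2_seminorm_le simp: hgap_def)
  show "holder2_seminorm (2 * \<alpha>) s t (remainder X (fst (y s)) (snd (y s))) \<le> ennreal (C * d s t ^ (n - 2))"
    using bd(3) unfolding hgap_power2 by (auto intro!: holder2_seminorm_le)
qed

lemma graded_with_controlled:
  assumes "graded_with C n y" "0 \<le> s" "s \<le> T"
  shows "controlled \<alpha> s T X (fst (y s)) (snd (y s))"
  unfolding controlled_def
  using graded_with_seminorms[OF assms order_refl, THEN le_less_trans, OF ennreal_less_top]
  by (simp add: infinity_ennreal_def)

end

theorem proposition3p4:
  fixes \<alpha> T :: real
    and X :: "real \<Rightarrow> real ^ 'd"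
    and XX :: "real \<Rightarrow> real \<Rightarrow> real ^ 'd ^ 'd"
    and Z :: "real \<Rightarrow> real ^ 'm"
    and Z' :: "real \<Rightarrow> (real ^ 'd) \<Rightarrow>\<^sub>L (real ^ 'm)"
    and p :: nat
  assumes "1 / 3 < \<alpha>" and "\<alpha> \<le> 1 / 2"
    and "0 < T"
    and "rough_path \<alpha> 0 T X XX"
    and "controlled \<alpha> 0 T X Z Z'"
    and "1 \<le> p"
  shows "\<exists>C>0. \<forall>s r t. 0 \<le> s \<and> s \<le> r \<and> r \<le> t \<and> t \<le> T \<longrightarrow>
    (\<forall>\<eta> \<in> forests_upto p.
       controlled \<alpha> s T X (forest_coeff XX Z Z' \<eta> s) (forest_coeff_deriv XX Z Z' \<eta> s) \<and>
       \<bar>forest_coeff XX Z Z' \<eta> s r\<bar> \<le> C * rpow \<bar>r - s\<bar> (real (vertices \<eta>) * \<alpha>) \<and>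
       norm (forest_coeff_deriv XX Z Z' \<eta> s r) \<le> C * rpow \<bar>r - s\<bar> ((real (vertices \<eta>) - 1) * \<alpha>) \<and>
       holder_seminorm \<alpha> s t (forest_coeff_deriv XX Z Z' \<eta> s) +
       holder2_seminorm (2 * \<alpha>) s t
         (remainder X (forest_coeff XX Z Z' \<eta> s) (forest_coeff_deriv XX Z Z' \<eta> s))
         \<le> ennreal (C * rpow \<bar>t - s\<bar> (max (real (vertices \<eta>) - 2) 0 * \<alpha>)))"
proof -
  have chen: "XX s t = XX s u + XX u t + tensor (X u - X s) (X t - X u)"
    if "0 \<le> s" "s \<le> u" "u \<le> t" "t \<le> T" for s u t
    using assms(4) that unfolding rough_path_def by blast
  have "holder2_seminorm \<alpha> 0 T (\<lambda>u v. X v - X u) < \<infinity>" and "holder2_seminorm (2 * \<alpha>) 0 T XX < \<infinity>"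
    using assms(4) by (simp_all add: rough_path_def holder_seminorm_def)
  note bounds = this[THEN holder2_seminorm_finiteD]
  obtain k1 where k1: "0 \<le> k1"
    "\<forall>u v. 0 \<le> u \<and> u < v \<and> v \<le> T \<longrightarrow> norm (X v - X u) \<le> k1 * (v - u) powr \<alpha>"
    using bounds(1) by blast
  obtain k2 where k2: "0 \<le> k2"
    "\<forall>u v. 0 \<le> u \<and> u < v \<and> v \<le> T \<longrightarrow> norm (XX u v) \<le> k2 * (v - u) powr (2 * \<alpha>)"
    using bounds(2) by blast
  define K where "K = k1 + k2"
  interpret rough_setting \<alpha> T K X XX
  proof
    fix u v :: real assume o: "0 \<le> u" "u \<le> v" "v \<le> T"
    have "XX u u = 0" using chen[of u u u] o by (simp add: tensor_def vec_eq_iff)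
    have "norm (X v - X u) \<le> k1 * hgap \<alpha> u v \<and> norm (XX u v) \<le> k2 * hgap \<alpha> u v ^ 2"
    proof (cases "u = v")
      case True
      thus ?thesis using \<open>XX u u = 0\<close> by (simp add: hgap_def)
    next
      case False
      thus ?thesis using k1(2) k2(2) o unfolding hgap_power2 by (simp add: hgap_def)
    qed
    moreover have "k1 * hgap \<alpha> u v \<le> K * hgap \<alpha> u v" "k2 * hgap \<alpha> u v ^ 2 \<le> K * hgap \<alpha> u v ^ 2"
      using k1(1) k2(1) by (simp_all add: K_def mult_right_mono hgap_def)
    ultimately show "norm (X v - X u) \<le> K * hgap \<alpha> u v" "norm (XX u v) \<le> K * hgap \<alpha> u v ^ 2"
      by linarith+
  next
    show "0 \<le> K" using k1(1) k2(1) by (simp add: K_def)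
  qed (rule assms(1,3) chen | assumption)+
  have "\<exists>C. graded_with C (vertices \<eta>) (\<lambda>s. forest_coeff_pair XX Z Z' s \<eta>)" for \<eta>
    using graded_forest[OF graded_tree[OF graded_component[OF assms(5)]]] by (simp add: graded_def)
  then obtain c where c: "\<And>\<eta>. graded_with (c \<eta>) (vertices \<eta>) (\<lambda>s. forest_coeff_pair XX Z Z' s \<eta>)"
    by metis
  \<comment> \<open>The factor 2 absorbs the sum of the two seminorms in the last estimate.\<close>
  define C where "C = 1 + 2 * (\<Sum>\<eta>\<in>forests_upto p. c \<eta>)"
  have c_nonneg: "0 \<le> c \<eta>" for \<eta> using c[of \<eta>] by (simp add: graded_with_def)
  hence C: "0 < C" by (auto simp: C_def intro!: add_pos_nonneg sum_nonneg)
  have cC: "c \<eta> \<le> C" "2 * c \<eta> \<le> C" if "\<eta> \<in> forests_upto p" for \<eta>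
  proof -
    have "c \<eta> \<le> (\<Sum>\<eta>\<in>forests_upto p. c \<eta>)"
      by (rule member_le_sum[OF that]) (simp_all add: c_nonneg finite_forests_upto)
    thus "c \<eta> \<le> C" "2 * c \<eta> \<le> C" using c_nonneg[of \<eta>] by (simp_all add: C_def)
  qed
  show ?thesis
  proof (intro exI[of _ C] conjI allI impI ballI C, goal_cases)
    case (1 s r t \<eta>)
    thus ?case using graded_with_controlled[OF c, of s \<eta>]
      by (simp add: forest_coeff_def[abs_def] forest_coeff_deriv_def[abs_def])
  next
    case (2 s r t \<eta>)
    hence "\<bar>forest_coeff XX Z Z' \<eta> s r\<bar> \<le> c \<eta> * hgap \<alpha> s r ^ vertices \<eta>"
      using graded_withD(2)[OF c, of s r r \<eta>] by (simp add: forest_coeff_def)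
    also have "\<dots> \<le> C * hgap \<alpha> s r ^ vertices \<eta>" using cC(1)[OF 2(2)] by (intro mult_right_mono) auto
    also have "hgap \<alpha> s r ^ vertices \<eta> = rpow \<bar>r - s\<bar> (real (vertices \<eta>) * \<alpha>)"
      using 2 alpha by (intro rpow_eq_hgap_power[symmetric]) auto
    finally show ?case .
  next
    case (3 s r t \<eta>)
    hence "norm (forest_coeff_deriv XX Z Z' \<eta> s r) \<le> c \<eta> * hgap \<alpha> s r ^ (vertices \<eta> - 1)"
      using graded_withD(3)[OF c, of s r r \<eta>] by (simp add: forest_coeff_deriv_def)
    also have "\<dots> \<le> C * hgap \<alpha> s r ^ (vertices \<eta> - 1)" using cC(1)[OF 3(2)] by (intro mult_right_mono) auto
    also have "hgap \<alpha> s r ^ (vertices \<eta> - 1) = rpow \<bar>r - s\<bar> (real (vertices \<eta> - 1) * \<alpha>)"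
      using 3 alpha by (intro rpow_eq_hgap_power[symmetric]) auto
    also have "real (vertices \<eta> - 1) = real (vertices \<eta>) - 1"
    proof -
      have "0 < size \<eta>" using 3(2) by (simp add: forests_upto_def nonempty_has_size)
      thus ?thesis using size_le_vertices[of \<eta>] by (simp add: of_nat_diff)
    qed
    finally show ?case .
  next
    case (4 s r t \<eta>)
    let ?q = "hgap \<alpha> s t ^ (vertices \<eta> - 2)"
    have st: "0 \<le> s" "s \<le> t" "t \<le> T" using 4(1) by auto
    have "holder_seminorm \<alpha> s t (forest_coeff_deriv XX Z Z' \<eta> s) +
       holder2_seminorm (2 * \<alpha>) s t
         (remainder X (forest_coeff XX Z Z' \<eta> s) (forest_coeff_deriv XX Z Z' \<eta> s))
       \<le> ennreal (c \<eta> * ?q) + ennreal (c \<eta> * ?q)"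
      using graded_with_seminorms(2,3)[OF c st, of \<eta>]
      by (intro add_mono) (simp_all add: forest_coeff_def[abs_def] forest_coeff_deriv_def[abs_def])
    also have "\<dots> = ennreal (2 * c \<eta> * ?q)" using c_nonneg[of \<eta>] by (simp flip: ennreal_plus)
    also have "\<dots> \<le> ennreal (C * ?q)" using cC(2)[OF 4(2)] by (intro ennreal_leI mult_right_mono) auto
    also have "?q = rpow \<bar>t - s\<bar> (real (vertices \<eta> - 2) * \<alpha>)"
      using st alpha by (intro rpow_eq_hgap_power[symmetric]) auto
    also have "real (vertices \<eta> - 2) = max (real (vertices \<eta>) - 2) 0" by (simp add: max_def)
    finally show ?case .
  qed
qed

end
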